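(* Let $(\mathcal C,\otimes,\mathbf I)$ be a preadditive strict monoidal category, $(V,\sigma)$ a pre-braided object in $\mathcal C$, and $(M,\rho)$ and $(N,\lambda)$ a right and a left braided $V$-module respectively. Then the morphisms $$({}^{\rho}d)_n:=(\rho\otimes\mathrm{Id}_{V^{\otimes(n-1)}}\otimes\mathrm{Id}_N)\circ(\mathrm{Id}_M\otimes\mathrm{csh}_{-\sigma}^{1,n-1}\otimes\mathrm{Id}_N),$$ $$(d^{\lambda})_n:=(-1)^{n-1}(\mathrm{Id}_M\otimes\mathrm{Id}_{V^{\otimes(n-1)}}\otimes\lambda)\circ(\mathrm{Id}_M\otimes\mathrm{csh}_{-\sigma}^{n-1,1}\otimes\mathrm{Id}_N)$$ define a bidegree $-1$ tensor bidifferential for $V$ with coefficients in $M$ and $N$.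
   Context: In a preadditive monoidal category, $\otimes$ is additive in each variable. For $\varphi:V^{\otimes l}\to V^{\otimes r}$, $\varphi_i=\mathrm{Id}_{V^{\otimes(i-1)}}\otimes\varphi\otimes\mathrm{Id}$. A pre-braided object is an object $V$ with a morphism $\sigma:V\otimes V\to V\otimes V$ (not necessarily invertible) such that $\sigma_1\sigma_2\sigma_1=\sigma_2\sigma_1\sigma_2$ on $V^{\otimes3}$; then $(V,-\sigma)$ is pre-braided as well. For a pre-braiding $\beta$ and $s\in S_n$ with shortest expression $s=\tau_{i_1}\cdots\tau_{i_k}$ in adjacent transpositions $\tau_i=(i\ i{+}1)$, $T_s^{\beta}=\beta_{i_1}\circ\cdots\circ\beta_{i_k}$ on $V^{\otimes n}$. With $Sh_{p,q}=\{s\in S_{p+q}: s(1)<\dots<s(p),\ s(p+1)<\dots<s(p+q)\}$, $\mathrm{csh}_{\beta}^{p,q}=\sum_{s\in Sh_{p,q}}T^{\beta}_{s^{-1}}:V^{\otimes(p+q)}\to V^{\otimes p}\otimes V^{\otimes q}$. A right braided $V$-module is an object $M$ with $\rho:M\otimes V\to M$ satisfying $\rho\circ(\rho\otimes\mathrm{Id}_V)=\rho\circ(\rho\otimes\mathrm{Id}_V)\circ(\mathrm{Id}_M\otimes\sigma)$. A left braided $V$-module is an object $N$ with $\lambda:V\otimes N\to N$ satisfying $\lambda\circ(\mathrm{Id}_V\otimes\lambda)=\lambda\circ(\mathrm{Id}_V\otimes\lambda)\circ(\sigma\otimes\mathrm{Id}_N)$. A bidegree $-1$ tensor bidifferential for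 $V$ with coefficients in $M$ and $N$ is a pair of families $d_n,d'_n:M\otimes V^{\otimes n}\otimes N\to M\otimes V^{\otimes(n-1)}\otimes N$ ($n>0$) with $d_{n-1}d_n=d'_{n-1}d'_n=d'_{n-1}d_n+d_{n-1}d'_n=0$ for all $n>1$. *)

theory Defs
  imports "HOL-Algebra.FiniteProduct" "HOL-Combinatorics.Permutations"
begin

section \<open>Preadditive strict monoidal categories\<close>

record ('o, 'm) cat =
  Obj :: "'o set"
  Arr :: "'m set"
  Dom :: "'m \<Rightarrow> 'o"
  Cod :: "'m \<Rightarrow> 'o"
  ident :: "'o \<Rightarrow> 'm" ("\<i>\<d>\<index>")
  cmp :: "'m \<Rightarrow> 'm \<Rightarrow> 'm" (infixl "\<cdot>\<index>" 65)

record ('o, 'm) mcat = "('o, 'm) cat" +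
  ten_obj :: "'o \<Rightarrow> 'o \<Rightarrow> 'o" (infixl "\<otimes>\<^sub>o\<index>" 70)
  ten_arr :: "'m \<Rightarrow> 'm \<Rightarrow> 'm" (infixl "\<otimes>\<^sub>m\<index>" 70)
  unit_obj :: "'o" ("\<I>\<index>")

record ('o, 'm) pmcat = "('o, 'm) mcat" +
  plus_arr :: "'m \<Rightarrow> 'm \<Rightarrow> 'm" (infixl "\<oplus>\<^sub>m\<index>" 60)
  zero_arr :: "'o \<Rightarrow> 'o \<Rightarrow> 'm" ("\<o>\<index>")

definition hom_set :: "('o, 'm, 'z) cat_scheme \<Rightarrow> 'o \<Rightarrow> 'o \<Rightarrow> 'm set" ("Hom\<index>") where
  "Hom\<^bsub>C\<^esub> A B = {f \<in> Arr C. Dom C f = A \<and> Cod C f = B}"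

text \<open>The additive group of morphisms from \<open>A\<close> to \<open>B\<close>, as a (multiplicatively written)
  group record: \<^const>\<open>finprod\<close> is then the finite sum, \<^const>\<open>m_inv\<close> the negation and
  the integer power the integer multiple.\<close>

definition hom_group :: "('o, 'm, 'z) pmcat_scheme \<Rightarrow> 'o \<Rightarrow> 'o \<Rightarrow> 'm monoid" where
  "hom_group C A B = \<lparr>carrier = Hom\<^bsub>C\<^esub> A B, monoid.mult = plus_arr C, one = zero_arr C A B\<rparr>"

definition neg_arr :: "('o, 'm, 'z) pmcat_scheme \<Rightarrow> 'm \<Rightarrow> 'm" where
  "neg_arr C f = m_inv (hom_group C (Dom C f) (Cod C f)) f"

definition scale_arr :: "('o, 'm, 'z) pmcat_scheme \<Rightarrow> int \<Rightarrow> 'm \<Rightarrow> 'm" where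
  "scale_arr C k f = f [^]\<^bsub>hom_group C (Dom C f) (Cod C f)\<^esub> k"

definition sum_arr ::
    "('o, 'm, 'z) pmcat_scheme \<Rightarrow> 'o \<Rightarrow> 'o \<Rightarrow> ('i \<Rightarrow> 'm) \<Rightarrow> 'i set \<Rightarrow> 'm" where
  "sum_arr C A B f S = finprod (hom_group C A B) f S"

locale category =
  fixes C :: "('o, 'm, 'z) cat_scheme" (structure)
  assumes dom_obj: "f \<in> Arr C \<Longrightarrow> Dom C f \<in> Obj C"
    and cod_obj: "f \<in> Arr C \<Longrightarrow> Cod C f \<in> Obj C"
    and ident_hom: "A \<in> Obj C \<Longrightarrow> \<i>\<d> A \<in> Hom A A"
    and cmp_hom: "\<lbrakk>f \<in> Hom X Y; g \<in> Hom Y Z\<rbrakk> \<Longrightarrow> g \<cdot> f \<in> Hom X Z"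
    and ident_left: "f \<in> Hom X Y \<Longrightarrow> \<i>\<d> Y \<cdot> f = f"
    and ident_right: "f \<in> Hom X Y \<Longrightarrow> f \<cdot> \<i>\<d> X = f"
    and cmp_assoc: "\<lbrakk>f \<in> Hom W X; g \<in> Hom X Y; h \<in> Hom Y Z\<rbrakk> \<Longrightarrow> (h \<cdot> g) \<cdot> f = h \<cdot> (g \<cdot> f)"

locale strict_monoidal_category = category C
  for C :: "('o, 'm, 'z) mcat_scheme" (structure) +
  assumes unit_in_Obj: "\<I> \<in> Obj C"
    and ten_obj_closed: "\<lbrakk>A \<in> Obj C; B \<in> Obj C\<rbrakk> \<Longrightarrow> A \<otimes>\<^sub>o B \<in> Obj C"
    and ten_hom: "\<lbrakk>f \<in> Hom A B; g \<in> Hom X Y\<rbrakk> \<Longrightarrow> f \<otimes>\<^sub>m g \<in> Hom (A \<otimes>\<^sub>o X) (B \<otimes>\<^sub>o Y)"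
    and ten_ident: "\<lbrakk>A \<in> Obj C; B \<in> Obj C\<rbrakk> \<Longrightarrow> \<i>\<d> A \<otimes>\<^sub>m \<i>\<d> B = \<i>\<d> (A \<otimes>\<^sub>o B)"
    and interchange: "\<lbrakk>f \<in> Hom A B; g \<in> Hom B D; f' \<in> Hom X Y; g' \<in> Hom Y Z\<rbrakk> \<Longrightarrow>
      (g \<cdot> f) \<otimes>\<^sub>m (g' \<cdot> f') = (g \<otimes>\<^sub>m g') \<cdot> (f \<otimes>\<^sub>m f')"
    and ten_obj_assoc: "\<lbrakk>A \<in> Obj C; B \<in> Obj C; D \<in> Obj C\<rbrakk> \<Longrightarrow>
      (A \<otimes>\<^sub>o B) \<otimes>\<^sub>o D = A \<otimes>\<^sub>o (B \<otimes>\<^sub>o D)"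
    and ten_arr_assoc: "\<lbrakk>f \<in> Arr C; g \<in> Arr C; h \<in> Arr C\<rbrakk> \<Longrightarrow>
      (f \<otimes>\<^sub>m g) \<otimes>\<^sub>m h = f \<otimes>\<^sub>m (g \<otimes>\<^sub>m h)"
    and unit_obj_left: "A \<in> Obj C \<Longrightarrow> \<I> \<otimes>\<^sub>o A = A"
    and unit_obj_right: "A \<in> Obj C \<Longrightarrow> A \<otimes>\<^sub>o \<I> = A"
    and unit_arr_left: "f \<in> Arr C \<Longrightarrow> \<i>\<d> \<I> \<otimes>\<^sub>m f = f"
    and unit_arr_right: "f \<in> Arr C \<Longrightarrow> f \<otimes>\<^sub>m \<i>\<d> \<I> = f"

locale preadditive_strict_monoidal_category = strict_monoidal_category C
  for C :: "('o, 'm, 'z) pmcat_scheme" (structure) +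
  assumes hom_comm_group: "\<lbrakk>A \<in> Obj C; B \<in> Obj C\<rbrakk> \<Longrightarrow> comm_group (hom_group C A B)"
    and cmp_plus_left: "\<lbrakk>f \<in> Hom X Y; g \<in> Hom Y Z; g' \<in> Hom Y Z\<rbrakk> \<Longrightarrow>
      (g \<oplus>\<^sub>m g') \<cdot> f = (g \<cdot> f) \<oplus>\<^sub>m (g' \<cdot> f)"
    and cmp_plus_right: "\<lbrakk>f \<in> Hom X Y; f' \<in> Hom X Y; g \<in> Hom Y Z\<rbrakk> \<Longrightarrow>
      g \<cdot> (f \<oplus>\<^sub>m f') = (g \<cdot> f) \<oplus>\<^sub>m (g \<cdot> f')"
    and ten_plus_left: "\<lbrakk>f \<in> Hom A B; f' \<in> Hom A B; g \<in> Hom X Y\<rbrakk> \<Longrightarrow>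
      (f \<oplus>\<^sub>m f') \<otimes>\<^sub>m g = (f \<otimes>\<^sub>m g) \<oplus>\<^sub>m (f' \<otimes>\<^sub>m g)"
    and ten_plus_right: "\<lbrakk>f \<in> Hom A B; g \<in> Hom X Y; g' \<in> Hom X Y\<rbrakk> \<Longrightarrow>
      f \<otimes>\<^sub>m (g \<oplus>\<^sub>m g') = (f \<otimes>\<^sub>m g) \<oplus>\<^sub>m (f \<otimes>\<^sub>m g')"

section \<open>Pre-braided objects and braided modules\<close>

primrec tpow :: "('o, 'm, 'z) mcat_scheme \<Rightarrow> 'o \<Rightarrow> nat \<Rightarrow> 'o" where
  "tpow C V 0 = \<I>\<^bsub>C\<^esub>"
| "tpow C V (Suc n) = V \<otimes>\<^sub>o\<^bsub>C\<^esub> tpow C V n"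

text \<open>\<open>ampl C V l n \<phi> i\<close> is \<open>\<phi>\<close>, with source the \<open>l\<close>-th tensor power of \<open>V\<close>, acting on the
  \<open>n\<close>-th tensor power from position \<open>i\<close> on; meaningful for \<open>1 \<le> i\<close> and \<open>i - 1 + l \<le> n\<close>.\<close>

definition ampl ::
    "('o, 'm, 'z) mcat_scheme \<Rightarrow> 'o \<Rightarrow> nat \<Rightarrow> nat \<Rightarrow> 'm \<Rightarrow> nat \<Rightarrow> 'm" where
  "ampl C V l n \<phi> i =
     \<i>\<d>\<^bsub>C\<^esub> (tpow C V (i - 1)) \<otimes>\<^sub>m\<^bsub>C\<^esub> \<phi> \<otimes>\<^sub>m\<^bsub>C\<^esub> \<i>\<d>\<^bsub>C\<^esub> (tpow C V (n - (i - 1 + l)))"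

definition prebraided_object :: "('o, 'm, 'z) mcat_scheme \<Rightarrow> 'o \<Rightarrow> 'm \<Rightarrow> bool" where
  "prebraided_object C V \<sigma> \<longleftrightarrow>
     V \<in> Obj C \<and> \<sigma> \<in> Hom\<^bsub>C\<^esub> (V \<otimes>\<^sub>o\<^bsub>C\<^esub> V) (V \<otimes>\<^sub>o\<^bsub>C\<^esub> V) \<and>
     ampl C V 2 3 \<sigma> 1 \<cdot>\<^bsub>C\<^esub> ampl C V 2 3 \<sigma> 2 \<cdot>\<^bsub>C\<^esub> ampl C V 2 3 \<sigma> 1 =
     ampl C V 2 3 \<sigma> 2 \<cdot>\<^bsub>C\<^esub> ampl C V 2 3 \<sigma> 1 \<cdot>\<^bsub>C\<^esub> ampl C V 2 3 \<sigma> 2"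

definition right_braided_module ::
    "('o, 'm, 'z) mcat_scheme \<Rightarrow> 'o \<Rightarrow> 'm \<Rightarrow> 'o \<Rightarrow> 'm \<Rightarrow> bool" where
  "right_braided_module C V \<sigma> M \<rho> \<longleftrightarrow>
     M \<in> Obj C \<and> \<rho> \<in> Hom\<^bsub>C\<^esub> (M \<otimes>\<^sub>o\<^bsub>C\<^esub> V) M \<and>
     \<rho> \<cdot>\<^bsub>C\<^esub> (\<rho> \<otimes>\<^sub>m\<^bsub>C\<^esub> \<i>\<d>\<^bsub>C\<^esub> V) =
     \<rho> \<cdot>\<^bsub>C\<^esub> (\<rho> \<otimes>\<^sub>m\<^bsub>C\<^esub> \<i>\<d>\<^bsub>C\<^esub> V) \<cdot>\<^bsub>C\<^esub> (\<i>\<d>\<^bsub>C\<^esub> M \<otimes>\<^sub>m\<^bsub>C\<^esub> \<sigma>)"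

definition left_braided_module ::
    "('o, 'm, 'z) mcat_scheme \<Rightarrow> 'o \<Rightarrow> 'm \<Rightarrow> 'o \<Rightarrow> 'm \<Rightarrow> bool" where
  "left_braided_module C V \<sigma> N lam \<longleftrightarrow>
     N \<in> Obj C \<and> lam \<in> Hom\<^bsub>C\<^esub> (V \<otimes>\<^sub>o\<^bsub>C\<^esub> N) N \<and>
     lam \<cdot>\<^bsub>C\<^esub> (\<i>\<d>\<^bsub>C\<^esub> V \<otimes>\<^sub>m\<^bsub>C\<^esub> lam) =
     lam \<cdot>\<^bsub>C\<^esub> (\<i>\<d>\<^bsub>C\<^esub> V \<otimes>\<^sub>m\<^bsub>C\<^esub> lam) \<cdot>\<^bsub>C\<^esub> (\<sigma> \<otimes>\<^sub>m\<^bsub>C\<^esub> \<i>\<d>\<^bsub>C\<^esub> N)"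

section \<open>Quantum coshuffles\<close>

text \<open>\<open>S\<^sub>n\<close> is \<open>{s. s permutes {1..n}}\<close>, with product \<open>(s t)(k) = s (t k)\<close>.\<close>

definition word_perm :: "nat list \<Rightarrow> nat \<Rightarrow> nat" where
  "word_perm is = foldr (\<lambda>i s. transpose i (Suc i) \<circ> s) is id"

definition shortest_word :: "nat \<Rightarrow> (nat \<Rightarrow> nat) \<Rightarrow> nat list \<Rightarrow> bool" where
  "shortest_word n s is \<longleftrightarrow> set is \<subseteq> {1..<n} \<and> word_perm is = s \<and>
     (\<forall>js. set js \<subseteq> {1..<n} \<and> word_perm js = s \<longrightarrow> length is \<le> length js)"

definition T_word ::
    "('o, 'm, 'z) mcat_scheme \<Rightarrow> 'o \<Rightarrow> 'm \<Rightarrow> nat \<Rightarrow> nat list \<Rightarrow> 'm" where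
  "T_word C V \<beta> n is =
     foldr (\<lambda>i f. ampl C V 2 n \<beta> i \<cdot>\<^bsub>C\<^esub> f) is (\<i>\<d>\<^bsub>C\<^esub> (tpow C V n))"

text \<open>For a pre-braiding \<open>\<beta>\<close> the choice of the shortest word is immaterial, by Matsumoto's
  theorem on reduced words.\<close>

definition T_perm ::
    "('o, 'm, 'z) mcat_scheme \<Rightarrow> 'o \<Rightarrow> 'm \<Rightarrow> nat \<Rightarrow> (nat \<Rightarrow> nat) \<Rightarrow> 'm" where
  "T_perm C V \<beta> n s = T_word C V \<beta> n (SOME is. shortest_word n s is)"

definition Sh :: "nat \<Rightarrow> nat \<Rightarrow> (nat \<Rightarrow> nat) set" where
  "Sh p q = {s. s permutes {1..p + q} \<and> strict_mono_on {1..p} s \<and> strict_mono_on {p + 1..p + q} s}"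

definition csh ::
    "('o, 'm, 'z) pmcat_scheme \<Rightarrow> 'o \<Rightarrow> 'm \<Rightarrow> nat \<Rightarrow> nat \<Rightarrow> 'm" where
  "csh C V \<beta> p q =
     sum_arr C (tpow C V (p + q)) (tpow C V p \<otimes>\<^sub>o\<^bsub>C\<^esub> tpow C V q)
       (\<lambda>s. T_perm C V \<beta> (p + q) (inv_into UNIV s)) (Sh p q)"

section \<open>Tensor bidifferentials\<close>

definition coeff_tpow :: "('o, 'm, 'z) mcat_scheme \<Rightarrow> 'o \<Rightarrow> 'o \<Rightarrow> 'o \<Rightarrow> nat \<Rightarrow> 'o" where
  "coeff_tpow C V M N n = M \<otimes>\<^sub>o\<^bsub>C\<^esub> tpow C V n \<otimes>\<^sub>o\<^bsub>C\<^esub> N"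

text \<open>Only the values \<open>d n\<close>, \<open>d' n\<close> with \<open>n > 0\<close> matter.\<close>

definition tensor_bidifferential ::
    "('o, 'm, 'z) pmcat_scheme \<Rightarrow> 'o \<Rightarrow> 'o \<Rightarrow> 'o \<Rightarrow> (nat \<Rightarrow> 'm) \<Rightarrow> (nat \<Rightarrow> 'm) \<Rightarrow> bool" where
  "tensor_bidifferential C V M N d d' \<longleftrightarrow>
     (\<forall>n>0. d n \<in> Hom\<^bsub>C\<^esub> (coeff_tpow C V M N n) (coeff_tpow C V M N (n - 1)) \<and>
            d' n \<in> Hom\<^bsub>C\<^esub> (coeff_tpow C V M N n) (coeff_tpow C V M N (n - 1))) \<and>
     (\<forall>n>1. let z = \<o>\<^bsub>C\<^esub> (coeff_tpow C V M N n) (coeff_tpow C V M N (n - 2)) in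
        d (n - 1) \<cdot>\<^bsub>C\<^esub> d n = z \<and>
        d' (n - 1) \<cdot>\<^bsub>C\<^esub> d' n = z \<and>
        (d' (n - 1) \<cdot>\<^bsub>C\<^esub> d n) \<oplus>\<^sub>m\<^bsub>C\<^esub> (d (n - 1) \<cdot>\<^bsub>C\<^esub> d' n) = z)"

definition d_rho ::
    "('o, 'm, 'z) pmcat_scheme \<Rightarrow> 'o \<Rightarrow> 'm \<Rightarrow> 'o \<Rightarrow> 'm \<Rightarrow> 'o \<Rightarrow> nat \<Rightarrow> 'm" where
  "d_rho C V \<sigma> M \<rho> N n =
     (\<rho> \<otimes>\<^sub>m\<^bsub>C\<^esub> \<i>\<d>\<^bsub>C\<^esub> (tpow C V (n - 1)) \<otimes>\<^sub>m\<^bsub>C\<^esub> \<i>\<d>\<^bsub>C\<^esub> N) \<cdot>\<^bsub>C\<^esub>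
     (\<i>\<d>\<^bsub>C\<^esub> M \<otimes>\<^sub>m\<^bsub>C\<^esub> csh C V (neg_arr C \<sigma>) 1 (n - 1) \<otimes>\<^sub>m\<^bsub>C\<^esub> \<i>\<d>\<^bsub>C\<^esub> N)"

definition d_lambda ::
    "('o, 'm, 'z) pmcat_scheme \<Rightarrow> 'o \<Rightarrow> 'm \<Rightarrow> 'o \<Rightarrow> 'o \<Rightarrow> 'm \<Rightarrow> nat \<Rightarrow> 'm" where
  "d_lambda C V \<sigma> M N lam n = scale_arr C ((-1) ^ (n - 1))
     ((\<i>\<d>\<^bsub>C\<^esub> M \<otimes>\<^sub>m\<^bsub>C\<^esub> \<i>\<d>\<^bsub>C\<^esub> (tpow C V (n - 1)) \<otimes>\<^sub>m\<^bsub>C\<^esub> lam) \<cdot>\<^bsub>C\<^esub>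
      (\<i>\<d>\<^bsub>C\<^esub> M \<otimes>\<^sub>m\<^bsub>C\<^esub> csh C V (neg_arr C \<sigma>) (n - 1) 1 \<otimes>\<^sub>m\<^bsub>C\<^esub> \<i>\<d>\<^bsub>C\<^esub> N))"

end

theory Submission
  imports Defs "HOL-Algebra.UnivPoly"
begin

text \<open>Write \<open>\<beta> = -\<sigma>\<close> and let \<open>b\<^sub>i\<close> be \<open>\<beta>\<close> acting at position \<open>i\<close>
  inside \<open>M \<otimes> V\<^sup>n \<otimes> N\<close>; the \<open>b\<^sub>i\<close> satisfy the braid relations in the endomorphism ring of that
  object. A shuffle in \<open>Sh 1 (n - 1)\<close> or \<open>Sh (n - 1) 1\<close> moves a single strand, so it has only one
  shortest word: any other word of that length would move the strand less far. Hence the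
  choice in the definition of \<^const>\<open>T_perm\<close> is forced, and
  \<open>csh 1 (n - 1) = (\<Sum>k=1..n. b\<^sub>1 \<cdots> b\<^bsub>k-1\<^esub>)\<close> and
  \<open>csh (n - 1) 1 = (\<Sum>k=1..n. b\<^bsub>n-1\<^esub> \<cdots> b\<^sub>k)\<close>.

  In a composite of two differentials the inner action (of \<open>V\<close> on \<open>M\<close> or \<open>N\<close>) slides past the outer
  coshuffle by the interchange law. The composite becomes a fixed double action
  \<open>L\<close> applied to a product of two sums of words, and everything is decided in the endomorphism ring.

  For the square of the first differential the product is the sum of all
  \<open>(b\<^sub>2 \<cdots> b\<^bsub>j-1\<^esub>)(b\<^sub>1 \<cdots> b\<^bsub>k-1\<^esub>)\<close>. Sliding letters along \<open>b\<^sub>1 \<cdots> b\<^bsub>j-1\<^esub>\<close> shows that the term at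
  \<open>(k + 1, j)\<close> is \<open>b\<^sub>1\<close> times the term at \<open>(j, k)\<close> whenever \<open>k < j\<close>, so \<open>1 + b\<^sub>1\<close> is a left factor of the
  whole sum (lemma \<open>coshuffle_square_factor\<close>). The module axiom says \<open>L = L \<sigma>\<^sub>1\<close>, that is
  \<open>L (1 + b\<^sub>1) = 0\<close>. The second differential follows from the same identity for the reversed
  family \<open>b\<^bsub>n-i\<^esub>\<close>. For the mixed relation both composites contain \<open>\<rho>\<close> and \<open>\<lambda>\<close> acting at opposite ends,
  which commute, and the two products of coshuffles agree term by term
  (lemma \<open>coshuffles_exchange\<close>); the signs \<open>(-1)\<^bsup>n-1\<^esup>\<close> and \<open>(-1)\<^bsup>n-2\<^esup>\<close> then make the sum vanish.\<close>

section \<open>Reduced words of one-strand shuffles\<close>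

lemma word_perm_Nil [simp]: "word_perm [] = id"
  and word_perm_Cons [simp]: "word_perm (i # w) = transpose i (Suc i) \<circ> word_perm w"
  by (simp_all add: word_perm_def)

lemma word_perm_append: "word_perm (v @ w) = word_perm v \<circ> word_perm w"
  by (induction v) (simp_all add: comp_assoc)

lemma word_perm_rev_inverse: "word_perm (rev w) \<circ> word_perm w = id"
proof (induction w)
  case (Cons i w)
  then show ?case
    by (simp add: word_perm_append fun_eq_iff)
qed simp

lemma inv_word_perm: "inv_into UNIV (word_perm w) = word_perm (rev w)"
  using word_perm_rev_inverse[of w] word_perm_rev_inverse[of "rev w"]
  by (intro inv_unique_comp) auto

lemma word_perm_permutes:
  assumes "set w \<subseteq> {1..<n}"
  shows "word_perm w permutes {1..n}"
  using assms
proof (induction w)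
  case (Cons i w)
  then have "transpose i (Suc i) permutes {1..n}"
    by (intro permutes_swap_id) auto
  with Cons have "transpose i (Suc i) \<circ> word_perm w permutes {1..n}"
    by (intro permutes_compose) auto
  then show ?case by (simp only: word_perm_Cons)
qed (auto simp: permutes_id)

text \<open>Each letter is an adjacent transposition and so moves a given point by at most one place. So a
  word that carries \<open>k\<close> to \<open>j\<close> has at least \<open>\<bar>k - j\<bar>\<close> letters.\<close>

lemma word_perm_displacement:
  "k \<le> word_perm w k + length w" "word_perm w k \<le> k + length w"
  by (induction w) (auto simp: transpose_def)

text \<open>By the displacement bound every letter of such a word must lower the image of \<open>k\<close> by exactly one,
  and this determines the letters one after the other.\<close>

lemma descending_word_unique:
  assumes "word_perm w k = j" "j \<le> k" "length w \<le> k - j"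
  shows "w = [j..<k]"
  using assms
proof (induction w arbitrary: j)
  case (Cons i w)
  let ?m = "word_perm w k"
  have "k \<le> ?m + length w" by (rule word_perm_displacement)
  with Cons.prems have m: "?m \<ge> Suc j" "j < k" by auto
  moreover have "transpose i (Suc i) ?m = j" using Cons.prems by simp
  ultimately have "?m = Suc j" "i = j" by (auto simp: transpose_def split: if_splits)
  with Cons.IH[of "Suc j"] Cons.prems m show ?case by (simp add: upt_conv_Cons)
qed simp

lemma ascending_word_unique:
  assumes "word_perm w k = j" "k \<le> j" "length w \<le> j - k"
  shows "w = rev [k..<j]"
  using assms
proof (induction w arbitrary: j)
  case (Cons i w)
  let ?m = "word_perm w k"
  have "?m \<le> k + length w" by (rule word_perm_displacement)
  with Cons.prems have m: "Suc ?m \<le> j" "k < j" by auto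
  moreover have "transpose i (Suc i) ?m = j" using Cons.prems by simp
  ultimately have "j = Suc ?m" "i = ?m" by (auto simp: transpose_def split: if_splits)
  with Cons.IH[of ?m] Cons.prems m show ?case by (auto simp: upt_Suc_append)
qed simp

lemma word_perm_upt:
  "j \<le> k \<Longrightarrow> word_perm [j..<k] x = (if x = k then j else if j \<le> x \<and> x < k then Suc x else x)"
proof (induction k arbitrary: x)
  case (Suc k)
  show ?case
  proof (cases "j = Suc k")
    case False
    with Suc have "word_perm [j..<Suc k] x = word_perm [j..<k] (transpose k (Suc k) x)"
      by (simp add: word_perm_append upt_Suc_append)
    with Suc False show ?thesis by (auto simp: transpose_def)
  qed simp
qed simp

lemma word_perm_rev_upt:
  "j \<le> k \<Longrightarrow> word_perm (rev [j..<k]) x = (if x = j then k else if j < x \<and> x \<le> k then x - 1 else x)"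
proof (induction k arbitrary: x)
  case (Suc k)
  show ?case
  proof (cases "j = Suc k")
    case False
    with Suc have "word_perm (rev [j..<Suc k]) x = transpose k (Suc k) (word_perm (rev [j..<k]) x)"
      by (simp add: upt_Suc_append)
    with Suc False show ?thesis by (auto simp: transpose_def)
  qed auto
qed auto

lemma shortest_word_upt:
  assumes "1 \<le> j" "j \<le> k" "k \<le> n"
  shows "shortest_word n (word_perm [j..<k]) w \<longleftrightarrow> w = [j..<k]"
proof
  have k: "word_perm [j..<k] k = j" using assms by (simp add: word_perm_upt)
  show "w = [j..<k]" if "shortest_word n (word_perm [j..<k]) w"
  proof (rule descending_word_unique)
    have "set [j..<k] \<subseteq> {1..<n}" using assms by auto
    then have "length w \<le> length [j..<k]" using that unfolding shortest_word_def by blast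
    then show "length w \<le> k - j" by simp
    show "word_perm w k = j" using that k by (simp add: shortest_word_def)
  qed (rule assms)
  show "shortest_word n (word_perm [j..<k]) w" if "w = [j..<k]"
  proof -
    have "k - j \<le> length js" if "word_perm js = word_perm [j..<k]" for js
      using word_perm_displacement(1)[of k js] that k by simp
    then show ?thesis using assms that by (auto simp: shortest_word_def)
  qed
qed

lemma shortest_word_rev_upt:
  assumes "1 \<le> j" "j \<le> k" "k \<le> n"
  shows "shortest_word n (word_perm (rev [j..<k])) w \<longleftrightarrow> w = rev [j..<k]"
proof
  have k: "word_perm (rev [j..<k]) j = k" using assms by (simp add: word_perm_rev_upt)
  show "w = rev [j..<k]" if "shortest_word n (word_perm (rev [j..<k])) w"
  proof (rule ascending_word_unique)
    have "set (rev [j..<k]) \<subseteq> {1..<n}" using assms by auto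
    then have "length w \<le> length (rev [j..<k])" using that unfolding shortest_word_def by blast
    then show "length w \<le> k - j" by simp
    show "word_perm w j = k" using that k by (simp add: shortest_word_def)
  qed (rule assms)
  show "shortest_word n (word_perm (rev [j..<k])) w" if "w = rev [j..<k]"
  proof -
    have "k - j \<le> length js" if "word_perm js = word_perm (rev [j..<k])" for js
      using word_perm_displacement(2)[of js j] that k by simp
    then show ?thesis using assms that by (auto simp: shortest_word_def)
  qed
qed

lemma T_perm_upt:
  assumes "1 \<le> j" "j \<le> k" "k \<le> n"
  shows "T_perm C V \<beta> n (word_perm [j..<k]) = T_word C V \<beta> n [j..<k]"
    and "T_perm C V \<beta> n (word_perm (rev [j..<k])) = T_word C V \<beta> n (rev [j..<k])"
  by (simp_all add: T_perm_def shortest_word_upt[OF assms] shortest_word_rev_upt[OF assms])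

text \<open>An increasing enumeration is determined by its image; this makes a shuffle that fixes the place of one
  strand unique.\<close>

lemma strict_mono_on_eq_if_image_eq:
  fixes f g :: "nat \<Rightarrow> nat"
  assumes "strict_mono_on A f" "strict_mono_on A g" "f ` A = g ` A" "x \<in> A"
  shows "f x = g x"
  using \<open>x \<in> A\<close>
proof (induction x rule: less_induct)
  case (less x)
  have False if fg: "f x < g x" and mono: "strict_mono_on A f" "strict_mono_on A g"
    and eq: "f ` A = g ` A" and IH: "\<And>y. y < x \<Longrightarrow> y \<in> A \<Longrightarrow> f y = g y" for f g :: "nat \<Rightarrow> nat"
  proof -
    obtain y where y: "y \<in> A" "f x = g y" using eq less.prems by blast
    then have "g y < g x" using fg by simp
    then have "y < x"
      using strict_mono_onD[OF mono(2) less.prems \<open>y \<in> A\<close>] by (cases x y rule: linorder_cases) auto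
    then have "f y < f x" using strict_mono_onD[OF mono(1) \<open>y \<in> A\<close> less.prems] by simp
    then show False using y IH[OF \<open>y < x\<close> \<open>y \<in> A\<close>] by simp
  qed
  from this[of f g] this[of g f] show ?case using assms less.IH by (metis linorder_neqE_nat)
qed

lemma permutes_eq_if_strict_mono_on_rest:
  fixes s t :: "nat \<Rightarrow> nat"
  assumes "s permutes S" "t permutes S" "s a = t a" 
    and "strict_mono_on (S - {a}) s" "strict_mono_on (S - {a}) t"
  shows "s = t"
proof
  fix x
  have "s ` (S - {a}) = t ` (S - {a})" 
    using assms(1-3) by (simp add: image_set_diff permutes_inj permutes_image)
  then show "s x = t x"
    using strict_mono_on_eq_if_image_eq[of "S - {a}" s t x] assms
    by (cases "x \<in> S - {a}") (auto simp: permutes_not_in)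
qed

text \<open>The index \<open>k\<close> is the image of the single strand under the shuffle.\<close>

lemma bij_betw_Sh_first:
  assumes "n \<ge> 1"
  shows "bij_betw (\<lambda>k. word_perm (rev [1..<k])) {1..n} (Sh 1 (n - 1))"
proof (rule bij_betwI[where g = "\<lambda>s. s 1"])
  have Sh: "word_perm (rev [1..<k]) \<in> Sh 1 (n - 1)" if "k \<in> {1..n}" for k
  proof -
    have "word_perm (rev [1..<k]) permutes {1..n}"
      using that by (intro word_perm_permutes) auto
    then show ?thesis using that assms by (auto simp: Sh_def word_perm_rev_upt strict_mono_on_def)
  qed
  show "(\<lambda>k. word_perm (rev [1..<k])) \<in> {1..n} \<rightarrow> Sh 1 (n - 1)" using Sh by blast
  have s1: "s 1 \<in> {1..n}" if "s \<in> Sh 1 (n - 1)" for s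
  proof -
    have "s permutes {1..n}" using that assms by (simp add: Sh_def)
    from permutes_in_image[OF this, of 1] show ?thesis using assms by simp
  qed
  then show "(\<lambda>s. s 1) \<in> Sh 1 (n - 1) \<rightarrow> {1..n}" by blast
  show "word_perm (rev [1..<k]) 1 = k" if "k \<in> {1..n}" for k
    using that by (simp add: word_perm_rev_upt)
  show "word_perm (rev [1..<s 1]) = s" if "s \<in> Sh 1 (n - 1)" for s
  proof (rule permutes_eq_if_strict_mono_on_rest[where a = 1 and S = "{1..n}"])
    have "{1..n} - {1} = {1 + 1..1 + (n - 1)}" using assms by auto
    then show "strict_mono_on ({1..n} - {1}) s"
      "strict_mono_on ({1..n} - {1}) (word_perm (rev [1..<s 1]))"
      using that Sh[OF s1[OF that]] by (simp_all add: Sh_def)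
    show "s permutes {1..n}" "word_perm (rev [1..<s 1]) permutes {1..n}"
      using that Sh[OF s1[OF that]] assms by (simp_all add: Sh_def)
    show "word_perm (rev [1..<s 1]) 1 = s 1"
      using s1[OF that] by (simp add: word_perm_rev_upt)
  qed
qed

lemma bij_betw_Sh_last:
  assumes "n \<ge> 1"
  shows "bij_betw (\<lambda>k. word_perm [k..<n]) {1..n} (Sh (n - 1) 1)"
proof (rule bij_betwI[where g = "\<lambda>s. s n"])
  have Sh: "word_perm [k..<n] \<in> Sh (n - 1) 1" if "k \<in> {1..n}" for k
  proof -
    have "word_perm [k..<n] permutes {1..n}"
      using that by (intro word_perm_permutes) auto
    then show ?thesis using that assms by (auto simp: Sh_def word_perm_upt strict_mono_on_def)
  qed
  show "(\<lambda>k. word_perm [k..<n]) \<in> {1..n} \<rightarrow> Sh (n - 1) 1" using Sh by blast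
  have sn: "s n \<in> {1..n}" if "s \<in> Sh (n - 1) 1" for s
  proof -
    have "s permutes {1..n}" using that assms by (simp add: Sh_def)
    from permutes_in_image[OF this, of n] show ?thesis using assms by simp
  qed
  then show "(\<lambda>s. s n) \<in> Sh (n - 1) 1 \<rightarrow> {1..n}" by blast
  show "word_perm [k..<n] n = k" if "k \<in> {1..n}" for k
    using that by (simp add: word_perm_upt)
  show "word_perm [s n..<n] = s" if "s \<in> Sh (n - 1) 1" for s
  proof (rule permutes_eq_if_strict_mono_on_rest[where a = n and S = "{1..n}"])
    have "{1..n} - {n} = {1..n - 1}" using assms by auto
    then show "strict_mono_on ({1..n} - {n}) s"
      "strict_mono_on ({1..n} - {n}) (word_perm [s n..<n])"
      using that Sh[OF sn[OF that]] by (simp_all add: Sh_def)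
    show "s permutes {1..n}" "word_perm [s n..<n] permutes {1..n}"
      using that Sh[OF sn[OF that]] assms by (simp_all add: Sh_def)
    show "word_perm [s n..<n] n = s n"
      using sn[OF that] by (simp add: word_perm_upt)
  qed
qed

section \<open>Coshuffle identities in a ring\<close>

lemma (in ring) finsum_product:
  assumes "finite I" "finite J" "f \<in> I \<rightarrow> carrier R" "g \<in> J \<rightarrow> carrier R"
  shows "(\<Oplus>i\<in>I. f i) \<otimes> (\<Oplus>j\<in>J. g j) = (\<Oplus>p\<in>I \<times> J. f (fst p) \<otimes> g (snd p))"
  using assms(1,3)
proof (induction I rule: finite_induct)
  case empty
  then show ?case using assms by simp
next
  case (insert i I)
  let ?h = "\<lambda>p. f (fst p) \<otimes> g (snd p)"
  have split: "insert i I \<times> J = Pair i ` J \<union> I \<times> J" by auto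
  have "(\<Oplus>i\<in>insert i I. f i) \<otimes> (\<Oplus>j\<in>J. g j)
      = f i \<otimes> (\<Oplus>j\<in>J. g j) \<oplus> (\<Oplus>p\<in>I \<times> J. ?h p)"
    using insert assms by (simp add: l_distr Pi_def)
  also have "f i \<otimes> (\<Oplus>j\<in>J. g j) = (\<Oplus>p\<in>Pair i ` J. ?h p)"
    using insert assms by (subst finsum_reindex) (auto simp: finsum_rdistr inj_on_def Pi_def)
  also have "\<dots> \<oplus> (\<Oplus>p\<in>I \<times> J. ?h p) = (\<Oplus>p\<in>insert i I \<times> J. ?h p)"
    unfolding split using insert assms by (subst finsum_Un_disjoint) (auto simp: Pi_def)
  finally show ?case .
qed

definition word_prod :: "('a, 'b) ring_scheme \<Rightarrow> (nat \<Rightarrow> 'a) \<Rightarrow> nat list \<Rightarrow> 'a" where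
  "word_prod R b w = foldr (\<lambda>i x. b i \<otimes>\<^bsub>R\<^esub> x) w \<one>\<^bsub>R\<^esub>"

lemma word_prod_Nil [simp]: "word_prod R b [] = \<one>\<^bsub>R\<^esub>"
  and word_prod_Cons [simp]: "word_prod R b (i # w) = b i \<otimes>\<^bsub>R\<^esub> word_prod R b w"
  by (simp_all add: word_prod_def)

lemma word_prod_map: "word_prod R b (map f w) = word_prod R (\<lambda>i. b (f i)) w"
  by (induction w) simp_all

text \<open>The braid relations of type \<open>A\<close>. Only the letters \<open>1, \<dots>, n - 1\<close> are constrained.\<close>

locale braid_family = ring R for R (structure) +
  fixes b :: "nat \<Rightarrow> 'a" and n :: nat
  assumes b_closed: "i \<in> {1..<n} \<Longrightarrow> b i \<in> carrier R"
    and far_commute: "\<lbrakk>1 \<le> i; Suc i < j; j < n\<rbrakk> \<Longrightarrow> b i \<otimes> b j = b j \<otimes> b i"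
    and braid: "\<lbrakk>1 \<le> i; Suc i < n\<rbrakk> \<Longrightarrow>
      b i \<otimes> b (Suc i) \<otimes> b i = b (Suc i) \<otimes> b i \<otimes> b (Suc i)"
begin

lemma braid_family_uminus: "braid_family R (\<lambda>i. \<ominus> b i) n"
proof
  show "\<ominus> b i \<in> carrier R" if "i \<in> {1..<n}" for i
    using that b_closed by simp
  show "\<ominus> b i \<otimes> \<ominus> b j = \<ominus> b j \<otimes> \<ominus> b i" if "1 \<le> i" "Suc i < j" "j < n" for i j
    using that far_commute[of i j] b_closed by (simp add: l_minus r_minus)
  show "\<ominus> b i \<otimes> \<ominus> b (Suc i) \<otimes> \<ominus> b i = \<ominus> b (Suc i) \<otimes> \<ominus> b i \<otimes> \<ominus> b (Suc i)"
    if "1 \<le> i" "Suc i < n" for i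
    using that braid[of i] b_closed by (simp add: l_minus r_minus)
qed

abbreviation W :: "nat list \<Rightarrow> 'a" where "W \<equiv> word_prod R b"

lemma W_closed [simp]: "set w \<subseteq> {1..<n} \<Longrightarrow> W w \<in> carrier R"
  by (induction w) (auto simp: b_closed)

lemma W_append:
  "\<lbrakk>set v \<subseteq> {1..<n}; set w \<subseteq> {1..<n}\<rbrakk> \<Longrightarrow> W (v @ w) = W v \<otimes> W w"
  by (induction v) (auto simp: b_closed m_assoc)

lemma b_W_commute:
  assumes "i \<in> {1..<n}" "set w \<subseteq> {1..<n}" "\<And>j. j \<in> set w \<Longrightarrow> Suc i < j \<or> Suc j < i"
  shows "b i \<otimes> W w = W w \<otimes> b i"
  using assms(2,3)
proof (induction w)
  case (Cons j w)
  have j: "b i \<otimes> b j = b j \<otimes> b i"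
    using Cons.prems(1) Cons.prems(2)[of j] assms(1) far_commute[of i j] far_commute[of j i] by auto
  have cl: "b i \<in> carrier R" "b j \<in> carrier R" "W w \<in> carrier R"
    using Cons.prems assms(1) by (auto intro!: b_closed)
  have "b i \<otimes> W (j # w) = b j \<otimes> (b i \<otimes> W w)"
    using cl j by (simp add: m_assoc[symmetric])
  also have "b i \<otimes> W w = W w \<otimes> b i" using Cons by simp
  finally show ?case using cl by (simp add: m_assoc)
qed (use assms(1) b_closed in simp)

lemma W_W_commute:
  assumes "set v \<subseteq> {1..<n}" "set w \<subseteq> {1..<n}"
    and "\<And>i j. i \<in> set v \<Longrightarrow> j \<in> set w \<Longrightarrow> Suc i < j \<or> Suc j < i"
  shows "W v \<otimes> W w = W w \<otimes> W v"
  using assms(1,3)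
proof (induction v)
  case (Cons i v)
  have cl: "b i \<in> carrier R" "W v \<in> carrier R" "W w \<in> carrier R"
    using Cons.prems assms(2) by (auto intro!: b_closed)
  have "W (i # v) \<otimes> W w = b i \<otimes> (W v \<otimes> W w)" using cl by (simp add: m_assoc)
  also have "W v \<otimes> W w = W w \<otimes> W v" using Cons by simp
  also have "b i \<otimes> (W w \<otimes> W v) = b i \<otimes> W w \<otimes> W v" using cl by (simp add: m_assoc)
  also have "b i \<otimes> W w = W w \<otimes> b i" using Cons.prems assms(2) by (intro b_W_commute) auto
  finally show ?case using cl by (simp add: m_assoc)
qed (use assms(2) in simp)

text \<open>The cyclic word \<open>1, \<dots>, m\<close> turns \<open>b\<^sub>i\<close> on its right into
  \<open>b\<^bsub>i+1\<^esub>\<close> on its left: far letters are passed freely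
  and the two letters \<open>i\<close>, \<open>i + 1\<close> are handled by one braid relation.\<close>

lemma slide_letter:
  assumes "1 \<le> i" "i < m" "m < n"
  shows "W [1..<Suc m] \<otimes> b i = b (Suc i) \<otimes> W [1..<Suc m]"
proof -
  let ?u = "W [1..<i]" and ?v = "W [Suc (Suc i)..<Suc m]"
  have cl: "?u \<in> carrier R" "?v \<in> carrier R" "b i \<in> carrier R" "b (Suc i) \<in> carrier R"
    using assms by (auto intro!: b_closed W_closed)
  have "[1..<Suc m] = [1..<i] @ [i..<Suc m]"
    using assms upt_add_eq_append[of 1 i "Suc m - i"] by simp
  also have "[i..<Suc m] = i # Suc i # [Suc (Suc i)..<Suc m]"
    using assms by (simp add: upt_conv_Cons)
  finally have split: "W [1..<Suc m] = ?u \<otimes> (b i \<otimes> (b (Suc i) \<otimes> ?v))"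
    using assms by (simp only:) (subst W_append, auto)
  have "W [1..<Suc m] \<otimes> b i = ?u \<otimes> (b i \<otimes> (b (Suc i) \<otimes> (?v \<otimes> b i)))"
    unfolding split using cl by (simp add: m_assoc del: upt_Suc)
  also have "?v \<otimes> b i = b i \<otimes> ?v"
    using assms by (intro b_W_commute[symmetric]) auto
  also have "?u \<otimes> (b i \<otimes> (b (Suc i) \<otimes> (b i \<otimes> ?v))) = ?u \<otimes> (b i \<otimes> b (Suc i) \<otimes> b i) \<otimes> ?v"
    using cl by (simp add: m_assoc)
  also have "b i \<otimes> b (Suc i) \<otimes> b i = b (Suc i) \<otimes> b i \<otimes> b (Suc i)"
    using assms by (intro braid) auto
  also have "?u \<otimes> (b (Suc i) \<otimes> b i \<otimes> b (Suc i)) \<otimes> ?v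
      = (?u \<otimes> b (Suc i)) \<otimes> (b i \<otimes> (b (Suc i) \<otimes> ?v))"
    using cl by (simp add: m_assoc)
  also have "?u \<otimes> b (Suc i) = b (Suc i) \<otimes> ?u"
    using assms by (intro b_W_commute[symmetric]) auto
  finally show ?thesis unfolding split using cl by (simp add: m_assoc del: upt_Suc)
qed

lemma slide_word:
  assumes "set w \<subseteq> {1..<m}" "m < n"
  shows "W [1..<Suc m] \<otimes> W w = W (map Suc w) \<otimes> W [1..<Suc m]"
  using assms(1)
proof (induction w)
  case Nil
  have "W [1..<Suc m] \<in> carrier R" using assms(2) by (intro W_closed) auto
  then show ?case by simp
next
  case (Cons i w)
  have cl: "b i \<in> carrier R" "b (Suc i) \<in> carrier R" "W w \<in> carrier R"
    "W (map Suc w) \<in> carrier R" "W [1..<Suc m] \<in> carrier R"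
    using Cons.prems assms(2) by (fastforce intro!: b_closed W_closed)+
  have "W [1..<Suc m] \<otimes> W (i # w) = (W [1..<Suc m] \<otimes> b i) \<otimes> W w"
    using cl by (simp add: m_assoc del: upt_Suc)
  also have "W [1..<Suc m] \<otimes> b i = b (Suc i) \<otimes> W [1..<Suc m]"
    using Cons.prems assms(2) by (intro slide_letter) auto
  also have "\<dots> \<otimes> W w = b (Suc i) \<otimes> (W [1..<Suc m] \<otimes> W w)"
    using cl by (simp add: m_assoc del: upt_Suc)
  also have "W [1..<Suc m] \<otimes> W w = W (map Suc w) \<otimes> W [1..<Suc m]" using Cons by simp
  finally show ?case using cl by (simp add: m_assoc del: upt_Suc)
qed

text \<open>The index pairs split into the part \<open>k < j\<close> and its image under \<open>(j, k) \<mapsto> (k + 1, j)\<close>. By sliding, passing to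
  the image multiplies a term by \<open>b 1\<close> from the left.\<close>

lemma coshuffle_square_factor:
  assumes "n \<ge> 2"
  shows "\<exists>Z\<in>carrier R. (\<Oplus>j\<in>{2..n}. W [2..<j]) \<otimes> (\<Oplus>k\<in>{1..n}. W [1..<k]) = (\<one> \<oplus> b 1) \<otimes> Z"
proof -
  let ?g = "\<lambda>p. W [2..<fst p] \<otimes> W [1..<snd p]"
  define P where "P = {p \<in> {2..n} \<times> {1..n}. snd p < fst p}"
  \<comment> \<open>The reindexing under which a term is multiplied by \<open>b 1\<close>; its image is the part \<open>fst p \<le> snd p\<close>.\<close>
  define h where "h = (\<lambda>p::nat \<times> nat. (Suc (snd p), fst p))"
  have cl: "?g p \<in> carrier R" if "p \<in> {2..n} \<times> {1..n}" for p
    using that by (intro m_closed W_closed) auto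
  have b1: "b 1 \<in> carrier R" using assms by (intro b_closed) auto
  have fin: "finite P" unfolding P_def by (rule finite_subset[of _ "{2..n} \<times> {1..n}"]) auto
  have P_sub: "P \<subseteq> {2..n} \<times> {1..n}" "h ` P \<subseteq> {2..n} \<times> {1..n}"
    by (auto simp: P_def h_def)
  have "inj_on h P" by (auto simp: inj_on_def h_def prod_eq_iff)
  have disj: "P \<inter> h ` P = {}" by (auto simp: P_def h_def)
  have "p \<in> P \<union> h ` P" if "p \<in> {2..n} \<times> {1..n}" for p
  proof (cases "snd p < fst p")
    case False
    then have "(snd p, fst p - 1) \<in> P" "p = h (snd p, fst p - 1)"
      using that by (auto simp: P_def h_def)
    then show ?thesis by blast
  qed (use that P_def in auto)
  then have union: "{2..n} \<times> {1..n} = P \<union> h ` P" using P_sub by blast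
  have pair: "?g (h p) = b 1 \<otimes> ?g p" if "p \<in> P" for p
  proof -
    obtain j k where p: "p = (j, k)" by (cases p)
    with that have jk: "1 \<le> k" "k < j" "j \<le> n" by (auto simp: P_def)
    from jk obtain m where m: "j = Suc m" by (cases j) auto
    have "?g (h p) = W (map Suc [1..<k]) \<otimes> W [1..<Suc m]"
      by (simp add: p m h_def map_Suc_upt numeral_2_eq_2)
    also have "\<dots> = W [1..<Suc m] \<otimes> W [1..<k]"
      using jk m by (intro slide_word[symmetric]) auto
    also have "[1..<Suc m] = 1 # [2..<j]" using jk m by (simp add: upt_conv_Cons numeral_2_eq_2 del: upt_Suc)
    also have "W (1 # [2..<j]) \<otimes> W [1..<k] = b 1 \<otimes> ?g p"
      using jk b1 p by (simp add: m_assoc)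
    finally show ?thesis .
  qed
  let ?Z = "\<Oplus>p\<in>P. ?g p"
  have Z: "?Z \<in> carrier R" using cl P_sub by (intro finsum_closed) auto
  have "(\<Oplus>j\<in>{2..n}. W [2..<j]) \<otimes> (\<Oplus>k\<in>{1..n}. W [1..<k]) = (\<Oplus>p\<in>{2..n} \<times> {1..n}. ?g p)"
    by (intro finsum_product) (auto intro!: W_closed)
  also have "\<dots> = ?Z \<oplus> (\<Oplus>p\<in>h ` P. ?g p)"
    unfolding union using fin disj cl P_sub by (intro finsum_Un_disjoint) auto
  also have "(\<Oplus>p\<in>h ` P. ?g p) = (\<Oplus>p\<in>P. ?g (h p))"
    using \<open>inj_on h P\<close> cl P_sub(2) by (intro finsum_reindex) auto
  also have "\<dots> = (\<Oplus>p\<in>P. b 1 \<otimes> ?g p)"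
    using pair cl P_sub(1) b1 by (intro finsum_cong') auto
  also have "\<dots> = b 1 \<otimes> ?Z"
    using fin b1 cl P_sub(1) by (intro finsum_rdistr[symmetric]) auto
  also have "?Z \<oplus> b 1 \<otimes> ?Z = (\<one> \<oplus> b 1) \<otimes> ?Z" using Z b1 by (simp add: l_distr)
  finally show ?thesis using Z by blast
qed

text \<open>Reading the strands from right to left preserves the braid relations, and exchanges the two kinds of
  coshuffles.\<close>

lemma braid_family_reverse: "braid_family R (\<lambda>i. b (n - i)) n"
proof
  show "b (n - i) \<in> carrier R" if "i \<in> {1..<n}" for i
    using that by (intro b_closed) auto
  show "b (n - i) \<otimes> b (n - j) = b (n - j) \<otimes> b (n - i)" if "1 \<le> i" "Suc i < j" "j < n" for i j
    using that by (intro far_commute[symmetric]) auto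
  show "b (n - i) \<otimes> b (n - Suc i) \<otimes> b (n - i) = b (n - Suc i) \<otimes> b (n - i) \<otimes> b (n - Suc i)"
    if "1 \<le> i" "Suc i < n" for i
    using braid[of "n - Suc i"] that by (simp add: Suc_diff_Suc)
qed

lemma map_reverse_upt:
  assumes "k \<le> l" "l \<le> Suc n"
  shows "map (\<lambda>i. n - i) [k..<l] = rev [Suc n - l..<Suc n - k]"
  using assms
  by (intro nth_equalityI) (auto simp: rev_nth)

lemma coshuffle_square_factor_reverse:
  assumes "n \<ge> 2"
  shows "\<exists>Z\<in>carrier R. (\<Oplus>j\<in>{1..n - 1}. W (rev [j..<n - 1])) \<otimes> (\<Oplus>k\<in>{1..n}. W (rev [k..<n]))
    = (\<one> \<oplus> b (n - 1)) \<otimes> Z"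
proof -
  interpret rev: braid_family R "\<lambda>i. b (n - i)" n by (rule braid_family_reverse)
  have W': "rev.W [k..<l] = W (rev [Suc n - l..<Suc n - k])" if "k \<le> l" "l \<le> Suc n" for k l
    using that by (simp add: word_prod_map[symmetric] map_reverse_upt)
  have "j \<in> (\<lambda>j. Suc n - j) ` {2..n}" if "j \<in> {1..n - 1}" for j
    using that by (intro rev_image_eqI[of "Suc n - j"]) auto
  moreover have "j \<in> (\<lambda>j. Suc n - j) ` {1..n}" if "j \<in> {1..n}" for j
    using that by (intro rev_image_eqI[of "Suc n - j"]) auto
  ultimately have img: "{1..n - 1} = (\<lambda>j. Suc n - j) ` {2..n}" "{1..n} = (\<lambda>j. Suc n - j) ` {1..n}"
    by auto
  have W_rev_closed: "W (rev [j..<l]) \<in> carrier R" if "Suc 0 \<le> j" "l \<le> n" for j l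
    using that by (intro W_closed) auto
  have "(\<Oplus>j\<in>{1..n - 1}. W (rev [j..<n - 1])) = (\<Oplus>j\<in>{2..n}. W (rev [Suc n - j..<n - 1]))"
    unfolding img(1) by (intro finsum_reindex) (auto simp: inj_on_def intro!: W_rev_closed)
  moreover have "(\<Oplus>k\<in>{1..n}. W (rev [k..<n])) = (\<Oplus>k\<in>{1..n}. W (rev [Suc n - k..<n]))"
    by (subst img(2), intro finsum_reindex) (auto simp: inj_on_def intro!: W_rev_closed)
  moreover have "(\<Oplus>j\<in>{2..n}. W (rev [Suc n - j..<n - 1])) = (\<Oplus>j\<in>{2..n}. rev.W [2..<j])"
    by (intro finsum_cong') (auto simp: W' intro!: W_rev_closed)
  moreover have "(\<Oplus>k\<in>{1..n}. W (rev [Suc n - k..<n])) = (\<Oplus>k\<in>{1..n}. rev.W [1..<k])"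
    by (intro finsum_cong') (auto simp: W' intro!: W_rev_closed)
  ultimately show ?thesis using rev.coshuffle_square_factor[OF assms] by simp
qed

text \<open>For \<open>j < k\<close> the two words have only far letters and commute. For \<open>k \<le> j\<close>, sliding turns the
  term at \<open>(j, k)\<close> on the left into the term at \<open>(k + 1, j + 1)\<close> on the right. Together this is a bijection between the
  index sets.\<close>

lemma coshuffles_exchange:
  assumes "n \<ge> 2"
  shows "(\<Oplus>j\<in>{1..n - 1}. W [1..<j]) \<otimes> (\<Oplus>k\<in>{1..n}. W (rev [k..<n]))
    = (\<Oplus>k\<in>{2..n}. W (rev [k..<n])) \<otimes> (\<Oplus>j\<in>{1..n}. W [1..<j])"
proof -
  let ?A = "{1..n - 1} \<times> {1..n}" and ?B = "{2..n} \<times> {1..n}"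
  let ?f = "\<lambda>p. W [1..<fst p] \<otimes> W (rev [snd p..<n])"
  let ?g = "\<lambda>p. W (rev [fst p..<n]) \<otimes> W [1..<snd p]"
  define h where "h = (\<lambda>p::nat \<times> nat. if fst p < snd p then (snd p, fst p)
    else (Suc (snd p), Suc (fst p)))"
  have bij: "bij_betw h ?A ?B"
    by (rule bij_betwI[where g = "\<lambda>p. if snd p < fst p then (snd p, fst p) else (snd p - 1, fst p - 1)"])
      (auto simp: h_def)
  have swap: "?f (j, k) = ?g (h (j, k))" if j: "j \<in> {1..n - 1}" and k: "k \<in> {1..n}" for j k
  proof (cases "j < k")
    case True
    then show ?thesis using j k by (simp add: h_def) (intro W_W_commute, auto)
  next
    case False
    let ?u = "W [1..<j]" and ?x = "W (rev [Suc j..<n])" and ?y = "W (rev [k..<j])"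
    let ?y' = "W (map Suc (rev [k..<j]))"
    have cl: "?u \<in> carrier R" "?x \<in> carrier R" "?y \<in> carrier R" "?y' \<in> carrier R"
      "b j \<in> carrier R" "W [1..<Suc j] \<in> carrier R"
      using j k False by (auto intro!: W_closed b_closed)
    have "j < n" using j by auto
    then have "[k..<n] = [k..<j] @ j # [Suc j..<n]"
      using upt_add_eq_append[of k j "n - j"] False by (simp add: upt_conv_Cons)
    then have "W (rev [k..<n]) = W (rev [Suc j..<n] @ j # rev [k..<j])" by simp
    also have "\<dots> = ?x \<otimes> (b j \<otimes> ?y)"
      using j k False by (subst W_append) auto
    finally have "?f (j, k) = (?u \<otimes> ?x) \<otimes> (b j \<otimes> ?y)" using cl by (simp add: m_assoc)
    also have "?u \<otimes> ?x = ?x \<otimes> ?u" using j by (intro W_W_commute) auto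
    also have "(?x \<otimes> ?u) \<otimes> (b j \<otimes> ?y) = ?x \<otimes> ((?u \<otimes> b j) \<otimes> ?y)" using cl by (simp add: m_assoc)
    also have "?u \<otimes> b j = W [1..<Suc j]"
      using \<open>j < n\<close> cl j W_append[of "[1..<j]" "[j]"] by simp
    also have "W [1..<Suc j] \<otimes> ?y = ?y' \<otimes> W [1..<Suc j]"
      using j k False by (intro slide_word) auto
    also have "?x \<otimes> (?y' \<otimes> W [1..<Suc j]) = W (rev [Suc j..<n] @ map Suc (rev [k..<j])) \<otimes> W [1..<Suc j]"
      using cl j k False by (subst W_append) (auto simp: m_assoc simp del: upt_Suc)
    also have "rev [Suc j..<n] @ map Suc (rev [k..<j]) = rev [Suc k..<n]"
      using upt_add_eq_append[of "Suc k" "Suc j" "n - Suc j"] \<open>j < n\<close> False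
      by (simp add: rev_map[symmetric] map_Suc_upt del: upt_Suc)
    finally show ?thesis using False by (simp add: h_def)
  qed
  have "(\<Oplus>j\<in>{1..n - 1}. W [1..<j]) \<otimes> (\<Oplus>k\<in>{1..n}. W (rev [k..<n])) = (\<Oplus>p\<in>?A. ?f p)"
    by (intro finsum_product) (auto intro!: W_closed)
  also have "\<dots> = (\<Oplus>p\<in>?A. ?g (h p))"
  proof (intro finsum_cong')
    have "?g p \<in> carrier R" if "p \<in> ?B" for p
      using that by (intro m_closed W_closed) auto
    then show "(\<lambda>p. ?g (h p)) \<in> ?A \<rightarrow> carrier R"
      using bij_betwE[OF bij] by blast
  qed (use swap in auto)
  also have "\<dots> = (\<Oplus>p\<in>h ` ?A. ?g p)"
    using bij by (intro finsum_reindex[symmetric])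
      (auto simp: bij_betw_def intro!: m_closed W_closed)
  also have "h ` ?A = ?B" using bij by (simp add: bij_betw_def)
  also have "(\<Oplus>p\<in>?B. ?g p) = (\<Oplus>k\<in>{2..n}. W (rev [k..<n])) \<otimes> (\<Oplus>j\<in>{1..n}. W [1..<j])"
    by (intro finsum_product[symmetric]) (auto intro!: W_closed)
  finally show ?thesis .
qed

end

section \<open>Whiskering and endomorphism rings\<close>

context category
begin

lemma Hom_Arr: "f \<in> Hom X Y \<Longrightarrow> f \<in> Arr C"
  and Hom_Dom: "f \<in> Hom X Y \<Longrightarrow> Dom C f = X"
  and Hom_Cod: "f \<in> Hom X Y \<Longrightarrow> Cod C f = Y"
  by (simp_all add: hom_set_def)

lemma Hom_Obj: "f \<in> Hom X Y \<Longrightarrow> X \<in> Obj C" "f \<in> Hom X Y \<Longrightarrow> Y \<in> Obj C"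
  using dom_obj cod_obj by (auto simp: hom_set_def)

text \<open>The shape in which two successive differentials are composed: the outer coshuffle \<open>c\<close> passes the inner action \<open>r\<close> and
  becomes \<open>y\<close>.\<close>

lemma cmp_slide:
  assumes "a \<in> Hom D E" "c \<in> Hom D D" "r \<in> Hom B D" "y \<in> Hom B B" "f \<in> Hom X B"
    and "c \<cdot> r = r \<cdot> y"
  shows "(a \<cdot> c) \<cdot> (r \<cdot> f) = (a \<cdot> r) \<cdot> (y \<cdot> f)"
proof -
  have "(a \<cdot> c) \<cdot> (r \<cdot> f) = a \<cdot> (c \<cdot> (r \<cdot> f))"
    using assms cmp_hom[OF assms(5,3)] by (intro cmp_assoc)
  also have "c \<cdot> (r \<cdot> f) = (c \<cdot> r) \<cdot> f" using assms by (intro cmp_assoc[symmetric])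
  also have "\<dots> = r \<cdot> (y \<cdot> f)" unfolding assms(6) using assms by (intro cmp_assoc)
  also have "a \<cdot> (r \<cdot> (y \<cdot> f)) = (a \<cdot> r) \<cdot> (y \<cdot> f)"
    using assms cmp_hom[OF assms(5,4)] by (intro cmp_assoc[symmetric])
  finally show ?thesis .
qed

end

definition whisker :: "('o, 'm, 'z) mcat_scheme \<Rightarrow> 'o \<Rightarrow> 'o \<Rightarrow> 'm \<Rightarrow> 'm" where
  "whisker C X Y f = \<i>\<d>\<^bsub>C\<^esub> X \<otimes>\<^sub>m\<^bsub>C\<^esub> f \<otimes>\<^sub>m\<^bsub>C\<^esub> \<i>\<d>\<^bsub>C\<^esub> Y"

context strict_monoidal_category
begin

lemmas obj_simps [simp] = unit_in_Obj ten_obj_closed unit_obj_left unit_obj_right ten_obj_assoc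

lemma whisker_hom:
  assumes "X \<in> Obj C" "Y \<in> Obj C" "f \<in> Hom A B"
  shows "whisker C X Y f \<in> Hom (X \<otimes>\<^sub>o A \<otimes>\<^sub>o Y) (X \<otimes>\<^sub>o B \<otimes>\<^sub>o Y)"
  unfolding whisker_def using assms by (intro ten_hom ident_hom)

lemma whisker_hom':
  assumes "X \<in> Obj C" "Y \<in> Obj C" "f \<in> Hom A B"
    and "P = X \<otimes>\<^sub>o A \<otimes>\<^sub>o Y" "Q = X \<otimes>\<^sub>o B \<otimes>\<^sub>o Y"
  shows "whisker C X Y f \<in> Hom P Q"
  using whisker_hom assms by simp

lemma whisker_cmp:
  assumes "X \<in> Obj C" "Y \<in> Obj C" "f \<in> Hom A B" "g \<in> Hom B D"
  shows "whisker C X Y (g \<cdot> f) = whisker C X Y g \<cdot> whisker C X Y f"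
proof -
  note id = ident_hom[OF assms(1)] ident_hom[OF assms(2)]
  have "whisker C X Y (g \<cdot> f) = ((\<i>\<d> X \<cdot> \<i>\<d> X) \<otimes>\<^sub>m (g \<cdot> f)) \<otimes>\<^sub>m (\<i>\<d> Y \<cdot> \<i>\<d> Y)"
    using id by (simp add: whisker_def ident_left)
  also have "\<dots> = ((\<i>\<d> X \<otimes>\<^sub>m g) \<cdot> (\<i>\<d> X \<otimes>\<^sub>m f)) \<otimes>\<^sub>m (\<i>\<d> Y \<cdot> \<i>\<d> Y)"
    using id assms interchange by metis
  also have "\<dots> = whisker C X Y g \<cdot> whisker C X Y f"
    unfolding whisker_def
    by (rule interchange[OF ten_hom[OF id(1) assms(3)] ten_hom[OF id(1) assms(4)] id(2) id(2)])
  finally show ?thesis .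
qed

lemma whisker_ident:
  "\<lbrakk>X \<in> Obj C; Y \<in> Obj C; A \<in> Obj C\<rbrakk> \<Longrightarrow> whisker C X Y (\<i>\<d> A) = \<i>\<d> (X \<otimes>\<^sub>o A \<otimes>\<^sub>o Y)"
  by (simp add: whisker_def ten_ident del: ten_obj_assoc)

lemma whisker_whisker:
  assumes "X \<in> Obj C" "Y \<in> Obj C" "X' \<in> Obj C" "Y' \<in> Obj C" "f \<in> Hom A B"
  shows "whisker C X Y (whisker C X' Y' f) = whisker C (X \<otimes>\<^sub>o X') (Y' \<otimes>\<^sub>o Y) f"
proof -
  note arr = assms(1-4)[THEN ident_hom, THEN Hom_Arr] assms(5)[THEN Hom_Arr]
  have "\<i>\<d> X' \<otimes>\<^sub>m f \<in> Arr C" "f \<otimes>\<^sub>m \<i>\<d> Y' \<in> Arr C" "\<i>\<d> Y' \<otimes>\<^sub>m \<i>\<d> Y \<in> Arr C"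
    "f \<otimes>\<^sub>m (\<i>\<d> Y' \<otimes>\<^sub>m \<i>\<d> Y) \<in> Arr C" "\<i>\<d> X' \<otimes>\<^sub>m (f \<otimes>\<^sub>m \<i>\<d> Y') \<in> Arr C"
    using assms by (metis ten_hom ident_hom Hom_Arr)+
  with arr show ?thesis
    using assms by (simp add: whisker_def ten_ident[symmetric] ten_arr_assoc)
qed

lemma whisker_unit_left: "\<lbrakk>f \<in> Hom A B; Y \<in> Obj C\<rbrakk> \<Longrightarrow> whisker C \<I> Y f = f \<otimes>\<^sub>m \<i>\<d> Y"
  by (simp add: whisker_def unit_arr_left Hom_Arr)

lemma whisker_unit_right: "\<lbrakk>f \<in> Hom A B; X \<in> Obj C\<rbrakk> \<Longrightarrow> whisker C X \<I> f = \<i>\<d> X \<otimes>\<^sub>m f"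
  by (simp add: whisker_def unit_arr_right Hom_Arr[OF ten_hom[OF ident_hom]])

text \<open>Morphisms acting on disjoint tensor factors commute. This one consequence of the interchange law
  covers far commutation of braidings, the passage of coshuffles through actions and the commutation of the
  actions on \<open>M\<close> and \<open>N\<close>.\<close>

lemma whisker_commute:
  assumes "X \<in> Obj C" "Y \<in> Obj C" "Z \<in> Obj C" and f: "f \<in> Hom A B" and g: "g \<in> Hom D E"
  shows "whisker C X (Z \<otimes>\<^sub>o E \<otimes>\<^sub>o Y) f \<cdot> whisker C (X \<otimes>\<^sub>o A \<otimes>\<^sub>o Z) Y g
    = whisker C (X \<otimes>\<^sub>o B \<otimes>\<^sub>o Z) Y g \<cdot> whisker C X (Z \<otimes>\<^sub>o D \<otimes>\<^sub>o Y) f"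
proof -
  note obj [simp] = assms(1-3) Hom_Obj[OF f] Hom_Obj[OF g]
  have wf: "whisker C X (Z \<otimes>\<^sub>o F \<otimes>\<^sub>o Y) f = whisker C X Y (whisker C \<I> (Z \<otimes>\<^sub>o F) f)"
    if "F \<in> Obj C" for F
    using that f by (subst whisker_whisker) (auto)
  have wg: "whisker C (X \<otimes>\<^sub>o F \<otimes>\<^sub>o Z) Y g = whisker C X Y (whisker C (F \<otimes>\<^sub>o Z) \<I> g)"
    if "F \<in> Obj C" for F
    using that g by (subst whisker_whisker) (auto)
  have Zg: "\<i>\<d> Z \<otimes>\<^sub>m g \<in> Hom (Z \<otimes>\<^sub>o D) (Z \<otimes>\<^sub>o E)" using g by (intro ten_hom ident_hom) auto
  have wf_hom: "whisker C \<I> (Z \<otimes>\<^sub>o F) f \<in> Hom (A \<otimes>\<^sub>o Z \<otimes>\<^sub>o F) (B \<otimes>\<^sub>o Z \<otimes>\<^sub>o F)"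
    if "F \<in> Obj C" for F using that f by (intro whisker_hom') auto
  have wg_hom: "whisker C (F \<otimes>\<^sub>o Z) \<I> g \<in> Hom (F \<otimes>\<^sub>o Z \<otimes>\<^sub>o D) (F \<otimes>\<^sub>o Z \<otimes>\<^sub>o E)"
    if "F \<in> Obj C" for F using that g by (intro whisker_hom') auto
  have wg': "whisker C (F \<otimes>\<^sub>o Z) \<I> g = \<i>\<d> F \<otimes>\<^sub>m (\<i>\<d> Z \<otimes>\<^sub>m g)" if "F \<in> Obj C" for F
    using that g ident_hom[of F] ident_hom[of Z]
    by (simp add: whisker_unit_right ten_ident[symmetric] ten_arr_assoc Hom_Arr)
  have "whisker C \<I> (Z \<otimes>\<^sub>o E) f \<cdot> whisker C (A \<otimes>\<^sub>o Z) \<I> g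
      = (f \<otimes>\<^sub>m \<i>\<d> (Z \<otimes>\<^sub>o E)) \<cdot> (\<i>\<d> A \<otimes>\<^sub>m (\<i>\<d> Z \<otimes>\<^sub>m g))"
    using f by (simp add: whisker_unit_left wg')
  also have "\<dots> = (f \<cdot> \<i>\<d> A) \<otimes>\<^sub>m (\<i>\<d> (Z \<otimes>\<^sub>o E) \<cdot> (\<i>\<d> Z \<otimes>\<^sub>m g))"
    by (rule interchange[OF ident_hom f Zg ident_hom, symmetric]) auto
  also have "\<dots> = (\<i>\<d> B \<cdot> f) \<otimes>\<^sub>m ((\<i>\<d> Z \<otimes>\<^sub>m g) \<cdot> \<i>\<d> (Z \<otimes>\<^sub>o D))"
    using f Zg by (simp add: ident_left ident_right)
  also have "\<dots> = (\<i>\<d> B \<otimes>\<^sub>m (\<i>\<d> Z \<otimes>\<^sub>m g)) \<cdot> (f \<otimes>\<^sub>m \<i>\<d> (Z \<otimes>\<^sub>o D))"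
    by (rule interchange[OF f ident_hom ident_hom Zg]) auto
  also have "\<dots> = whisker C (B \<otimes>\<^sub>o Z) \<I> g \<cdot> whisker C \<I> (Z \<otimes>\<^sub>o D) f"
    using f by (simp add: whisker_unit_left wg')
  finally have "whisker C X Y (whisker C \<I> (Z \<otimes>\<^sub>o E) f \<cdot> whisker C (A \<otimes>\<^sub>o Z) \<I> g)
      = whisker C X Y (whisker C (B \<otimes>\<^sub>o Z) \<I> g \<cdot> whisker C \<I> (Z \<otimes>\<^sub>o D) f)" by simp
  then show ?thesis
    using whisker_cmp[OF assms(1,2) wg_hom[OF obj(4)] wf_hom[OF obj(7)]]
      whisker_cmp[OF assms(1,2) wf_hom[OF obj(6)] wg_hom[OF obj(5)]]
    by (simp only: wf wg obj)
qed

lemma tpow_Obj [simp]: "V \<in> Obj C \<Longrightarrow> tpow C V n \<in> Obj C"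
  by (induction n) simp_all

lemma tpow_add: "V \<in> Obj C \<Longrightarrow> tpow C V (m + n) = tpow C V m \<otimes>\<^sub>o tpow C V n"
  by (induction m) simp_all

lemma tpow_Suc_right: "V \<in> Obj C \<Longrightarrow> tpow C V (Suc n) = tpow C V n \<otimes>\<^sub>o V"
  using tpow_add[of V n 1] by simp

end

text \<open>Packaging endomorphisms as a ring makes finite sums and their distributivity available, and makes
  whiskering a ring homomorphism.\<close>

definition End_ring :: "('o, 'm, 'z) pmcat_scheme \<Rightarrow> 'o \<Rightarrow> 'm ring" where
  "End_ring C A = \<lparr>carrier = Hom\<^bsub>C\<^esub> A A, monoid.mult = cmp C, one = ident C A,
    zero = zero_arr C A A, add = plus_arr C\<rparr>"

lemma End_ring_simps [simp]:
  "carrier (End_ring C A) = Hom\<^bsub>C\<^esub> A A" "f \<otimes>\<^bsub>End_ring C A\<^esub> g = f \<cdot>\<^bsub>C\<^esub> g"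
  "\<one>\<^bsub>End_ring C A\<^esub> = \<i>\<d>\<^bsub>C\<^esub> A" "\<zero>\<^bsub>End_ring C A\<^esub> = \<o>\<^bsub>C\<^esub> A A" "f \<oplus>\<^bsub>End_ring C A\<^esub> g = f \<oplus>\<^sub>m\<^bsub>C\<^esub> g"
  by (simp_all add: End_ring_def)

lemma add_monoid_End_ring: "add_monoid (End_ring C A) = hom_group C A A"
  by (simp add: End_ring_def hom_group_def)

lemma T_word_eq_word_prod:
  "T_word C V \<beta> n w = word_prod (End_ring C (tpow C V n)) (ampl C V 2 n \<beta>) w"
  by (simp add: T_word_def word_prod_def)

context preadditive_strict_monoidal_category
begin

lemma hom_group_simps [simp]:
  "carrier (hom_group C A B) = Hom A B" "f \<otimes>\<^bsub>hom_group C A B\<^esub> g = f \<oplus>\<^sub>m g"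
  "\<one>\<^bsub>hom_group C A B\<^esub> = \<o> A B"
  by (simp_all add: hom_group_def)

lemma ring_End_ring:
  assumes "A \<in> Obj C"
  shows "ring (End_ring C A)"
proof (rule ringI)
  interpret comm_group "hom_group C A A" by (rule hom_comm_group) fact+
  show "abelian_group (End_ring C A)"
    by (intro abelian_group.intro abelian_monoid.intro abelian_group_axioms.intro)
      (simp_all only: add_monoid_End_ring comm_monoid_axioms comm_group_axioms)
  show "monoid (End_ring C A)"
    using ident_hom[OF assms] by unfold_locales (auto intro: cmp_hom cmp_assoc ident_left ident_right)
qed (auto intro: cmp_plus_left cmp_plus_right)

lemma plus_hom: "\<lbrakk>f \<in> Hom A B; g \<in> Hom A B\<rbrakk> \<Longrightarrow> f \<oplus>\<^sub>m g \<in> Hom A B"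
  using comm_group.axioms(2)[OF hom_comm_group, THEN group.is_monoid, THEN monoid.m_closed] Hom_Obj
  by fastforce

lemma zero_hom: "\<lbrakk>A \<in> Obj C; B \<in> Obj C\<rbrakk> \<Longrightarrow> \<o> A B \<in> Hom A B"
  using comm_group.axioms(2)[OF hom_comm_group, THEN group.is_monoid, THEN monoid.one_closed]
  by fastforce

lemma plus_idem_zero:
  assumes "f \<in> Hom A B" "f \<oplus>\<^sub>m f = f"
  shows "f = \<o> A B"
proof -
  interpret comm_group "hom_group C A B" by (rule hom_comm_group) (use Hom_Obj assms in auto)
  show ?thesis using l_cancel_one[of f f] assms by simp
qed

lemma zero_plus_zero: "\<lbrakk>A \<in> Obj C; B \<in> Obj C\<rbrakk> \<Longrightarrow> \<o> A B \<oplus>\<^sub>m \<o> A B = \<o> A B"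
  using comm_group.axioms(2)[OF hom_comm_group, THEN group.is_monoid, THEN monoid.l_one, of A B "\<o> A B"]
    zero_hom by simp

lemma cmp_zero_right: "\<lbrakk>g \<in> Hom Y Z; X \<in> Obj C\<rbrakk> \<Longrightarrow> g \<cdot> \<o> X Y = \<o> X Z"
  using zero_hom[of X Y] Hom_Obj[of g Y Z]
  by (intro plus_idem_zero) (auto intro: cmp_hom simp: cmp_plus_right[symmetric] zero_plus_zero)

lemma cmp_zero_left: "\<lbrakk>f \<in> Hom X Y; Z \<in> Obj C\<rbrakk> \<Longrightarrow> \<o> Y Z \<cdot> f = \<o> X Z"
  using zero_hom[of Y Z] Hom_Obj[of f X Y]
  by (intro plus_idem_zero) (auto intro: cmp_hom simp: cmp_plus_left[symmetric] zero_plus_zero)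

lemma
  assumes "f \<in> Hom A B"
  shows neg_hom: "neg_arr C f \<in> Hom A B"
    and neg_plus: "neg_arr C f \<oplus>\<^sub>m f = \<o> A B"
    and plus_neg: "f \<oplus>\<^sub>m neg_arr C f = \<o> A B"
proof -
  interpret comm_group "hom_group C A B" by (rule hom_comm_group) (use Hom_Obj assms in auto)
  show "neg_arr C f \<in> Hom A B" "neg_arr C f \<oplus>\<^sub>m f = \<o> A B" "f \<oplus>\<^sub>m neg_arr C f = \<o> A B"
    using inv_closed[of f] l_inv[of f] r_inv[of f] assms
    by (simp_all add: neg_arr_def Hom_Dom[OF assms] Hom_Cod[OF assms])
qed

lemma neg_unique:
  assumes "f \<in> Hom A B" "g \<in> Hom A B" "g \<oplus>\<^sub>m f = \<o> A B"
  shows "neg_arr C f = g"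
proof -
  interpret comm_group "hom_group C A B" by (rule hom_comm_group) (use Hom_Obj assms in auto)
  show ?thesis using inv_equality[of g f] assms 
    by (simp add: neg_arr_def Hom_Dom[OF assms(1)] Hom_Cod[OF assms(1)])
qed

lemma neg_End_ring: "f \<in> Hom A A \<Longrightarrow> \<ominus>\<^bsub>End_ring C A\<^esub> f = neg_arr C f"
  unfolding a_inv_def add_monoid_End_ring by (simp add: neg_arr_def Hom_Dom Hom_Cod)

lemma cmp_neg_right:
  assumes "f \<in> Hom X Y" "g \<in> Hom Y Z"
  shows "g \<cdot> neg_arr C f = neg_arr C (g \<cdot> f)"
proof (rule neg_unique[symmetric])
  have "g \<cdot> neg_arr C f \<oplus>\<^sub>m g \<cdot> f = g \<cdot> (neg_arr C f \<oplus>\<^sub>m f)"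
    using cmp_plus_right[OF neg_hom[OF assms(1)] assms] by simp
  then show "g \<cdot> neg_arr C f \<oplus>\<^sub>m g \<cdot> f = \<o> X Z"
    using assms by (simp add: neg_plus cmp_zero_right Hom_Obj(1))
qed (use cmp_hom[OF assms] cmp_hom[OF neg_hom[OF assms(1)] assms(2)] in auto)

lemma cmp_neg_left:
  assumes "f \<in> Hom X Y" "g \<in> Hom Y Z"
  shows "neg_arr C g \<cdot> f = neg_arr C (g \<cdot> f)"
proof (rule neg_unique[symmetric])
  have "neg_arr C g \<cdot> f \<oplus>\<^sub>m g \<cdot> f = (neg_arr C g \<oplus>\<^sub>m g) \<cdot> f"
    using cmp_plus_left[OF assms(1) neg_hom[OF assms(2)] assms(2)] by simp
  then show "neg_arr C g \<cdot> f \<oplus>\<^sub>m g \<cdot> f = \<o> X Z"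
    using assms by (simp add: neg_plus cmp_zero_left Hom_Obj(2))
qed (use cmp_hom[OF assms] cmp_hom[OF assms(1) neg_hom[OF assms(2)]] in auto)

lemma scale_sign:
  assumes "f \<in> Hom A B"
  shows "scale_arr C ((-1) ^ k) f = (if even k then f else neg_arr C f)"
proof -
  interpret comm_group "hom_group C A B" by (rule hom_comm_group) (use Hom_Obj assms in auto)
  show ?thesis using assms int_pow_neg[of f 1] int_pow_1[of f]
    by (auto simp: scale_arr_def neg_arr_def Hom_Dom Hom_Cod)
qed

lemma whisker_plus:
  assumes "X \<in> Obj C" "Y \<in> Obj C" "f \<in> Hom A B" "g \<in> Hom A B"
  shows "whisker C X Y (f \<oplus>\<^sub>m g) = whisker C X Y f \<oplus>\<^sub>m whisker C X Y g"
  unfolding whisker_def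
  using ten_hom[OF ident_hom[OF assms(1)] assms(3)] ten_hom[OF ident_hom[OF assms(1)] assms(4)]
    ident_hom[OF assms(1)] ident_hom[OF assms(2)] assms
  by (simp add: ten_plus_right ten_plus_left)

lemma whisker_neg:
  assumes "X \<in> Obj C" "Y \<in> Obj C" "f \<in> Hom D E"
  shows "whisker C X Y (neg_arr C f) = neg_arr C (whisker C X Y f)"
proof (rule neg_unique[symmetric])
  show "whisker C X Y f \<in> Hom (X \<otimes>\<^sub>o D \<otimes>\<^sub>o Y) (X \<otimes>\<^sub>o E \<otimes>\<^sub>o Y)"
    and "whisker C X Y (neg_arr C f) \<in> Hom (X \<otimes>\<^sub>o D \<otimes>\<^sub>o Y) (X \<otimes>\<^sub>o E \<otimes>\<^sub>o Y)"
    using assms by (auto intro!: whisker_hom neg_hom simp del: ten_obj_assoc)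
  have DE: "D \<in> Obj C" "E \<in> Obj C" using Hom_Obj[OF assms(3)] .
  then have "whisker C X Y (\<o> D E) = \<o> (X \<otimes>\<^sub>o D \<otimes>\<^sub>o Y) (X \<otimes>\<^sub>o E \<otimes>\<^sub>o Y)"
    using assms(1,2) zero_hom[OF DE]
    by (intro plus_idem_zero whisker_hom) (simp_all add: whisker_plus[symmetric] zero_plus_zero)
  then show "whisker C X Y (neg_arr C f) \<oplus>\<^sub>m whisker C X Y f
      = \<o> (X \<otimes>\<^sub>o D \<otimes>\<^sub>o Y) (X \<otimes>\<^sub>o E \<otimes>\<^sub>o Y)"
    using whisker_plus[OF assms(1,2) neg_hom[OF assms(3)] assms(3)] neg_plus[OF assms(3)] by simp
qed

lemma ring_hom_whisker:
  assumes "X \<in> Obj C" "Y \<in> Obj C" "A \<in> Obj C"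
  shows "ring_hom_ring (End_ring C A) (End_ring C (X \<otimes>\<^sub>o A \<otimes>\<^sub>o Y)) (whisker C X Y)"
proof (rule ring_hom_ringI)
  show "ring (End_ring C A)" "ring (End_ring C (X \<otimes>\<^sub>o A \<otimes>\<^sub>o Y))"
    using assms by (auto intro!: ring_End_ring)
qed (use assms in \<open>auto simp: whisker_cmp whisker_plus whisker_ident simp del: ten_obj_assoc
  intro: whisker_hom\<close>)

text \<open>This is how the module axioms are used: a double action \<open>L\<close> absorbs the braiding \<open>s\<close>, hence it kills \<open>1 - s\<close>.\<close>

lemma absorbed_cmp_one_minus:
  assumes "L \<in> Hom A B" "s \<in> Hom A A" "L \<cdot> s = L"
  shows "L \<cdot> (\<i>\<d> A \<oplus>\<^sub>m neg_arr C s) = \<o> A B"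
proof -
  have A: "A \<in> Obj C" by (rule Hom_Obj(1)[OF assms(1)])
  have "L \<cdot> (\<i>\<d> A \<oplus>\<^sub>m neg_arr C s) = L \<oplus>\<^sub>m L \<cdot> neg_arr C s"
    using assms ident_hom[OF A] neg_hom[OF assms(2)] by (simp add: cmp_plus_right ident_right)
  also have "\<dots> = \<o> A B" using assms by (simp add: cmp_neg_right plus_neg)
  finally show ?thesis .
qed

end

lemma (in ring_hom_ring) hom_word_prod:
  assumes "\<And>i. i \<in> set w \<Longrightarrow> b i \<in> carrier R" "\<And>i. i \<in> set w \<Longrightarrow> h (b i) = c (f i)"
  shows "word_prod R b w \<in> carrier R \<and> h (word_prod R b w) = word_prod S c (map f w)"
  using assms by (induction w) auto

section \<open>Coshuffles as sums of words\<close>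

context preadditive_strict_monoidal_category
begin

lemma ampl_hom:
  assumes "V \<in> Obj C" "\<beta> \<in> Hom (V \<otimes>\<^sub>o V) (V \<otimes>\<^sub>o V)" "i \<in> {1..<n}"
  shows "ampl C V 2 n \<beta> i \<in> Hom (tpow C V n) (tpow C V n)"
proof -
  have n: "n = (i - 1) + (Suc (Suc 0) + (n - (i + 1)))" using assms(3) by auto
  have "tpow C V n = tpow C V (i - 1) \<otimes>\<^sub>o (V \<otimes>\<^sub>o V) \<otimes>\<^sub>o tpow C V (n - (i + 1))"
    using assms(1) by (subst n, subst tpow_add) simp_all
  moreover have "ampl C V 2 n \<beta> i = whisker C (tpow C V (i - 1)) (tpow C V (n - (i + 1))) \<beta>"
    using assms(3) by (simp add: ampl_def whisker_def)
  ultimately show ?thesis using assms by (auto intro: whisker_hom')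
qed

lemma T_word_hom:
  assumes "V \<in> Obj C" "\<beta> \<in> Hom (V \<otimes>\<^sub>o V) (V \<otimes>\<^sub>o V)" "set w \<subseteq> {1..<n}"
  shows "T_word C V \<beta> n w \<in> Hom (tpow C V n) (tpow C V n)"
  using assms(3)
proof (induction w)
  case (Cons i w)
  then have "ampl C V 2 n \<beta> i \<in> Hom (tpow C V n) (tpow C V n)"
    using assms by (intro ampl_hom) auto
  then show ?case using Cons cmp_hom by (auto simp: T_word_def)
qed (use assms(1) ident_hom in \<open>simp add: T_word_def\<close>)

lemma csh_eq_finsum:
  assumes "V \<in> Obj C" "\<beta> \<in> Hom (V \<otimes>\<^sub>o V) (V \<otimes>\<^sub>o V)"
    and bij: "bij_betw s I (Sh p q)"
    and w: "\<And>k. k \<in> I \<Longrightarrow> set (w k) \<subseteq> {1..<p + q}"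
    and T: "\<And>k. k \<in> I \<Longrightarrow> T_perm C V \<beta> (p + q) (inv_into UNIV (s k)) = T_word C V \<beta> (p + q) (w k)"
  shows "csh C V \<beta> p q = finsum (End_ring C (tpow C V (p + q))) (\<lambda>k. T_word C V \<beta> (p + q) (w k)) I"
proof -
  let ?A = "tpow C V (p + q)"
  let ?F = "\<lambda>t. T_perm C V \<beta> (p + q) (inv_into UNIV t)"
  interpret G: comm_group "hom_group C ?A ?A" using assms by (intro hom_comm_group) auto
  have cl: "T_word C V \<beta> (p + q) (w k) \<in> Hom ?A ?A" if "k \<in> I" for k
    using assms w[OF that] by (intro T_word_hom)
  have im: "s ` I = Sh p q" and inj: "inj_on s I" using bij by (auto simp: bij_betw_def)
  have F: "?F \<in> s ` I \<rightarrow> carrier (hom_group C ?A ?A)" using cl T by auto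
  have "csh C V \<beta> p q = finprod (hom_group C ?A ?A) ?F (s ` I)"
    using assms(1) by (simp add: csh_def sum_arr_def im tpow_add[symmetric])
  also have "\<dots> = finprod (hom_group C ?A ?A) (\<lambda>k. ?F (s k)) I"
    by (rule G.finprod_reindex[OF F inj])
  also have "\<dots> = finprod (hom_group C ?A ?A) (\<lambda>k. T_word C V \<beta> (p + q) (w k)) I"
    using T cl by (intro G.finprod_cong') auto
  finally show ?thesis unfolding finsum_def add_monoid_End_ring .
qed

lemma
  assumes "V \<in> Obj C" "\<beta> \<in> Hom (V \<otimes>\<^sub>o V) (V \<otimes>\<^sub>o V)" "n \<ge> 1"
  shows csh_first: "csh C V \<beta> 1 (n - 1)
      = finsum (End_ring C (tpow C V n)) (\<lambda>k. T_word C V \<beta> n [1..<k]) {1..n}"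
    and csh_last: "csh C V \<beta> (n - 1) 1
      = finsum (End_ring C (tpow C V n)) (\<lambda>k. T_word C V \<beta> n (rev [k..<n])) {1..n}"
proof -
  have n: "1 + (n - 1) = n" "n - 1 + 1 = n" using assms(3) by auto
  show "csh C V \<beta> 1 (n - 1)
      = finsum (End_ring C (tpow C V n)) (\<lambda>k. T_word C V \<beta> n [1..<k]) {1..n}"
  proof (rule csh_eq_finsum[OF assms(1,2) bij_betw_Sh_first[OF assms(3)], unfolded n])
    show "set [1..<k] \<subseteq> {1..<n}" if "k \<in> {1..n}" for k using that by auto
    show "T_perm C V \<beta> n (inv_into UNIV (word_perm (rev [1..<k]))) = T_word C V \<beta> n [1..<k]"
      if "k \<in> {1..n}" for k
      using that by (simp add: inv_word_perm T_perm_upt)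
  qed
  show "csh C V \<beta> (n - 1) 1
      = finsum (End_ring C (tpow C V n)) (\<lambda>k. T_word C V \<beta> n (rev [k..<n])) {1..n}"
  proof (rule csh_eq_finsum[OF assms(1,2) bij_betw_Sh_last[OF assms(3)], unfolded n])
    show "set (rev [k..<n]) \<subseteq> {1..<n}" if "k \<in> {1..n}" for k using that by auto
    show "T_perm C V \<beta> n (inv_into UNIV (word_perm [k..<n])) = T_word C V \<beta> n (rev [k..<n])"
      if "k \<in> {1..n}" for k
      using that by (simp add: inv_word_perm T_perm_upt)
  qed
qed

end

locale braided_coefficients = preadditive_strict_monoidal_category C
  for C :: "('o, 'm, 'z) pmcat_scheme" (structure) +
  fixes V :: 'o and \<sigma> :: 'm and M :: 'o and \<rho> :: 'm and N :: 'o and lam :: 'm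
  assumes prebraided: "prebraided_object C V \<sigma>"
    and right_module: "right_braided_module C V \<sigma> M \<rho>"
    and left_module: "left_braided_module C V \<sigma> N lam"
begin

lemma objs [simp]: "V \<in> Obj C" "M \<in> Obj C" "N \<in> Obj C"
  using prebraided right_module left_module
  by (auto simp: prebraided_object_def right_braided_module_def left_braided_module_def)

lemma sigma_hom: "\<sigma> \<in> Hom (V \<otimes>\<^sub>o V) (V \<otimes>\<^sub>o V)"
  and rho_hom: "\<rho> \<in> Hom (M \<otimes>\<^sub>o V) M"
  and lam_hom: "lam \<in> Hom (V \<otimes>\<^sub>o N) N"
  using prebraided right_module left_module
  by (auto simp: prebraided_object_def right_braided_module_def left_braided_module_def)

abbreviation T :: "nat \<Rightarrow> 'o" where "T n \<equiv> tpow C V n"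

lemma T_split2: "T (i + Suc (Suc j)) = T i \<otimes>\<^sub>o (V \<otimes>\<^sub>o V) \<otimes>\<^sub>o T j"
  by (subst tpow_add) simp_all

abbreviation A :: "nat \<Rightarrow> 'o" where "A n \<equiv> coeff_tpow C V M N n"

abbreviation (input) R :: "nat \<Rightarrow> 'm ring" where "R n \<equiv> End_ring C (A n)"

lemma A_Obj [simp]: "A n \<in> Obj C"
  by (simp add: coeff_tpow_def)

lemma A_split:
  "n = i + j \<Longrightarrow> A n = M \<otimes>\<^sub>o (T i \<otimes>\<^sub>o (T j \<otimes>\<^sub>o N))"
  by (simp add: coeff_tpow_def tpow_add)

text \<open>For \<open>1 \<le> i < n\<close> this is an endomorphism of \<open>A n\<close>; outside this range the truncated subtractions
  may change its source.\<close>

definition braid_at :: "'m \<Rightarrow> nat \<Rightarrow> nat \<Rightarrow> 'm" where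
  "braid_at \<beta> n i = whisker C (M \<otimes>\<^sub>o T (i - 1)) (T (n - (i + 1)) \<otimes>\<^sub>o N) \<beta>"

lemma braid_at_hom:
  assumes "\<beta> \<in> Hom (V \<otimes>\<^sub>o V) (V \<otimes>\<^sub>o V)" "i \<in> {1..<n}"
  shows "braid_at \<beta> n i \<in> Hom (A n) (A n)"
proof -
  have n: "n = (i - 1) + Suc (Suc (n - (i + 1)))" using assms(2) by auto
  have "A n = M \<otimes>\<^sub>o T (i - 1) \<otimes>\<^sub>o (V \<otimes>\<^sub>o V) \<otimes>\<^sub>o (T (n - (i + 1)) \<otimes>\<^sub>o N)"
    using A_split[OF n] by simp
  then show ?thesis
    unfolding braid_at_def using assms(1) by (intro whisker_hom') auto
qed

text \<open>Whiskering by \<open>j\<close> strands on the left and \<open>l\<close> on the right shifts positions by \<open>j\<close>. The inner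
  coshuffle acts on \<open>n - 1\<close> strands with the remaining strand consumed by \<open>\<rho>\<close> (\<open>j = 1\<close>) or by
  \<open>lam\<close> (\<open>l = 1\<close>).\<close>

lemma braid_at_eq_whisker:
  assumes "\<beta> \<in> Hom (V \<otimes>\<^sub>o V) (V \<otimes>\<^sub>o V)" "i \<in> {1..<m}"
  shows "whisker C (M \<otimes>\<^sub>o T j) (T l \<otimes>\<^sub>o N) (ampl C V 2 m \<beta> i) = braid_at \<beta> (j + m + l) (j + i)"
proof -
  have "T (j + i - 1) = T j \<otimes>\<^sub>o T (i - 1)"
    using assms(2) tpow_add[of V j "i - 1"] by simp
  moreover have "T (j + m + l - (j + i + 1)) = T (m - (i + 1)) \<otimes>\<^sub>o T l"
    using assms(2) tpow_add[of V "m - (i + 1)" l] by simp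
  moreover have "ampl C V 2 m \<beta> i = whisker C (T (i - 1)) (T (m - (i + 1))) \<beta>"
    using assms(2) by (simp add: ampl_def whisker_def)
  ultimately show ?thesis
    using assms(1) by (simp add: braid_at_def whisker_whisker)
qed

lemma braid_family_sigma: "braid_family (R n) (braid_at \<sigma> n) n"
proof -
  interpret ring "R n" by (rule ring_End_ring) simp
  show ?thesis
  proof
    show "braid_at \<sigma> n i \<in> carrier (R n)" if "i \<in> {1..<n}" for i
      using braid_at_hom[OF sigma_hom that] by simp
    show "braid_at \<sigma> n i \<otimes>\<^bsub>R n\<^esub> braid_at \<sigma> n j = braid_at \<sigma> n j \<otimes>\<^bsub>R n\<^esub> braid_at \<sigma> n i"
      if "1 \<le> i" "Suc i < j" "j < n" for i j
    proof -
      let ?X = "M \<otimes>\<^sub>o T (i - 1)" and ?Z = "T (j - i - 2)" and ?Y = "T (n - (j + 1)) \<otimes>\<^sub>o N"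
      have e: "n - (i + 1) = (j - i - 2) + Suc (Suc (n - (j + 1)))"
        "j - 1 = (i - 1) + Suc (Suc (j - i - 2))" using that by auto
      have "T (n - (i + 1)) \<otimes>\<^sub>o N = ?Z \<otimes>\<^sub>o (V \<otimes>\<^sub>o V) \<otimes>\<^sub>o ?Y"
        "M \<otimes>\<^sub>o T (j - 1) = ?X \<otimes>\<^sub>o (V \<otimes>\<^sub>o V) \<otimes>\<^sub>o ?Z"
        by (simp_all only: e T_split2) simp_all
      then show ?thesis
        using whisker_commute[of ?X ?Y ?Z, OF _ _ _ sigma_hom sigma_hom]
        by (simp add: braid_at_def del: ten_obj_assoc)
    qed
    show "braid_at \<sigma> n i \<otimes>\<^bsub>R n\<^esub> braid_at \<sigma> n (Suc i) \<otimes>\<^bsub>R n\<^esub> braid_at \<sigma> n i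
        = braid_at \<sigma> n (Suc i) \<otimes>\<^bsub>R n\<^esub> braid_at \<sigma> n i \<otimes>\<^bsub>R n\<^esub> braid_at \<sigma> n (Suc i)"
      if "1 \<le> i" "Suc i < n" for i
    proof -
      let ?w = "whisker C (M \<otimes>\<^sub>o T (i - 1)) (T (n - (i + 2)) \<otimes>\<^sub>o N)"
      let ?s = "ampl C V 2 3 \<sigma>"
      have w: "?w (?s k) = braid_at \<sigma> n (i - 1 + k)" if "k \<in> {1..<3}" for k
      proof -
        have n: "i - 1 + 3 + (n - (i + 2)) = n" using \<open>1 \<le> i\<close> \<open>Suc i < n\<close> by simp
        show ?thesis
          by (rule braid_at_eq_whisker[OF sigma_hom that, of "i - 1" "n - (i + 2)", unfolded n])
      qed
      have s: "?s 1 \<in> Hom (T 3) (T 3)" "?s 2 \<in> Hom (T 3) (T 3)"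
        by (auto intro!: ampl_hom sigma_hom)
      have mult: "?w (f \<cdot> g \<cdot> h) = ?w f \<cdot> ?w g \<cdot> ?w h"
        if "f \<in> Hom (T 3) (T 3)" "g \<in> Hom (T 3) (T 3)" "h \<in> Hom (T 3) (T 3)" for f g h
        using that cmp_hom[of g "T 3" "T 3" f "T 3"]
          whisker_cmp[of _ _ h "T 3" "T 3" "f \<cdot> g" "T 3"] whisker_cmp[of _ _ g "T 3" "T 3" f "T 3"]
        by simp
      have "?s 1 \<cdot> ?s 2 \<cdot> ?s 1 = ?s 2 \<cdot> ?s 1 \<cdot> ?s 2"
        using prebraided by (simp add: prebraided_object_def)
      then have "?w (?s 1 \<cdot> ?s 2 \<cdot> ?s 1) = ?w (?s 2 \<cdot> ?s 1 \<cdot> ?s 2)" by simp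
      then show ?thesis using w[of 1] w[of 2] mult s \<open>1 \<le> i\<close> by simp
    qed
  qed
qed

abbreviation b :: "nat \<Rightarrow> nat \<Rightarrow> 'm" where "b n \<equiv> braid_at (neg_arr C \<sigma>) n"

lemma neg_sigma_hom: "neg_arr C \<sigma> \<in> Hom (V \<otimes>\<^sub>o V) (V \<otimes>\<^sub>o V)"
  using sigma_hom by (rule neg_hom)

lemma b_eq_neg: "b n i = neg_arr C (braid_at \<sigma> n i)"
  unfolding braid_at_def using sigma_hom by (intro whisker_neg) auto

lemma braid_family_b: "braid_family (R n) (b n) n"
proof -
  interpret s: braid_family "R n" "braid_at \<sigma> n" n by (rule braid_family_sigma)
  interpret b: braid_family "R n" "\<lambda>i. \<ominus>\<^bsub>R n\<^esub> braid_at \<sigma> n i" n by (rule s.braid_family_uminus)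
  have b: "b n i = \<ominus>\<^bsub>R n\<^esub> braid_at \<sigma> n i" if "i \<in> {1..<n}" for i
    using that s.b_closed[OF that] by (simp add: neg_End_ring b_eq_neg)
  show ?thesis
    using b.b_closed b.far_commute b.braid s.ring_axioms
    by (auto simp: braid_family_def braid_family_axioms_def b)
qed

lemma whisker_sum_words:
  assumes "\<And>k. k \<in> I \<Longrightarrow> set (w k) \<subseteq> {1..<m}"
  shows "whisker C (M \<otimes>\<^sub>o T j) (T l \<otimes>\<^sub>o N)
      (finsum (End_ring C (T m)) (\<lambda>k. T_word C V (neg_arr C \<sigma>) m (w k)) I)
    = finsum (R (j + m + l)) (\<lambda>k. word_prod (R (j + m + l)) (b (j + m + l)) (map ((+) j) (w k))) I"
proof -
  let ?\<beta> = "neg_arr C \<sigma>" and ?X = "M \<otimes>\<^sub>o T j" and ?Y = "T l \<otimes>\<^sub>o N" and ?n = "j + m + l"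
  have A: "A ?n = ?X \<otimes>\<^sub>o T m \<otimes>\<^sub>o ?Y"
    using A_split[of ?n j "m + l"] by (simp add: tpow_add)
  interpret ring_hom_ring "End_ring C (T m)" "R ?n" "whisker C ?X ?Y"
    unfolding A by (intro ring_hom_whisker) auto
  have h: "T_word C V ?\<beta> m (w k) \<in> carrier (End_ring C (T m)) \<and>
      whisker C ?X ?Y (T_word C V ?\<beta> m (w k)) = word_prod (R ?n) (b ?n) (map ((+) j) (w k))"
    if "k \<in> I" for k
    unfolding T_word_eq_word_prod
    using assms[OF that] neg_sigma_hom
    by (intro hom_word_prod) (auto intro!: ampl_hom braid_at_eq_whisker)
  then have "whisker C ?X ?Y (finsum (End_ring C (T m)) (\<lambda>k. T_word C V ?\<beta> m (w k)) I)
      = finsum (R ?n) (whisker C ?X ?Y \<circ> (\<lambda>k. T_word C V ?\<beta> m (w k))) I"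
    by (intro hom_finsum) auto
  also have "\<dots> = finsum (R ?n) (\<lambda>k. word_prod (R ?n) (b ?n) (map ((+) j) (w k))) I"
  proof (intro S.finsum_cong')
    show "(\<lambda>k. word_prod (R ?n) (b ?n) (map ((+) j) (w k))) \<in> I \<rightarrow> carrier (R ?n)"
    proof
      fix k assume "k \<in> I"
      from h[OF this] show "word_prod (R ?n) (b ?n) (map ((+) j) (w k)) \<in> carrier (R ?n)"
        using hom_closed by fastforce
    qed
  qed (use h in auto)
  finally show ?thesis .
qed

section \<open>The bidifferential\<close>

abbreviation first_csh :: "nat \<Rightarrow> 'm" where "first_csh n \<equiv> csh C V (neg_arr C \<sigma>) 1 (n - 1)"
abbreviation last_csh :: "nat \<Rightarrow> 'm" where "last_csh n \<equiv> csh C V (neg_arr C \<sigma>) (n - 1) 1"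

abbreviation b_word :: "nat \<Rightarrow> nat list \<Rightarrow> 'm" where "b_word n \<equiv> word_prod (R n) (b n)"

lemma csh_hom: "first_csh (Suc n) \<in> Hom (T (Suc n)) (T (Suc n))" (is ?l)
    "last_csh (Suc n) \<in> Hom (T (Suc n)) (T (Suc n))" (is ?r)
proof -
  interpret ring "End_ring C (T (Suc n))" by (rule ring_End_ring) (rule tpow_Obj, rule objs)
  have "T_word C V (neg_arr C \<sigma>) (Suc n) [1..<k] \<in> Hom (T (Suc n)) (T (Suc n))"
    "T_word C V (neg_arr C \<sigma>) (Suc n) (rev [k..<Suc n]) \<in> Hom (T (Suc n)) (T (Suc n))"
    if "k \<in> {1..Suc n}" for k
    using that by (auto intro!: T_word_hom neg_sigma_hom simp del: tpow.simps)
  moreover have n: "1 \<le> Suc n" by simp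
  ultimately show ?l ?r
    unfolding csh_first[OF objs(1) neg_sigma_hom n] csh_last[OF objs(1) neg_sigma_hom n]
    using finsum_closed[of "\<lambda>k. T_word C V (neg_arr C \<sigma>) (Suc n) [1..<k]" "{1..Suc n}"]
      finsum_closed[of "\<lambda>k. T_word C V (neg_arr C \<sigma>) (Suc n) (rev [k..<Suc n])" "{1..Suc n}"]
    by (simp_all add: Pi_iff del: tpow.simps upt_Suc)
qed

lemma whisker_csh:
  assumes "n \<ge> 1"
  shows "whisker C M N (first_csh n) = finsum (R n) (\<lambda>k. b_word n [1..<k]) {1..n}"
    and "whisker C M N (last_csh n) = finsum (R n) (\<lambda>k. b_word n (rev [k..<n])) {1..n}"
  unfolding csh_first[OF objs(1) neg_sigma_hom assms] csh_last[OF objs(1) neg_sigma_hom assms]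
  using whisker_sum_words[of "{1..n}" "\<lambda>k. [1..<k]" n 0 0]
    whisker_sum_words[of "{1..n}" "\<lambda>k. rev [k..<n]" n 0 0]
  by (simp_all add: atLeastLessThan_subset_iff cong: map_cong)

text \<open>Here the action of \<open>V\<close> on \<open>N\<close> has yet to consume the last strand, so the coshuffle on the first
  \<open>m\<close> strands is extended by an idle strand on the right, and positions are unchanged.\<close>

lemma whisker_csh_right:
  assumes "m \<ge> 1"
  shows "whisker C M (V \<otimes>\<^sub>o N) (first_csh m) = finsum (R (Suc m)) (\<lambda>k. b_word (Suc m) [1..<k]) {1..m}"
    and "whisker C M (V \<otimes>\<^sub>o N) (last_csh m) = finsum (R (Suc m)) (\<lambda>k. b_word (Suc m) (rev [k..<m])) {1..m}"
  unfolding csh_first[OF objs(1) neg_sigma_hom assms] csh_last[OF objs(1) neg_sigma_hom assms]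
  using whisker_sum_words[of "{1..m}" "\<lambda>k. [1..<k]" m 0 1]
    whisker_sum_words[of "{1..m}" "\<lambda>k. rev [k..<m]" m 0 1]
  by (simp_all add: atLeastLessThan_subset_iff cong: map_cong)

text \<open>Dually, the first strand is idle and all positions move up by one.\<close>

lemma whisker_csh_left:
  assumes "m \<ge> 1"
  shows "whisker C (M \<otimes>\<^sub>o V) N (first_csh m)
      = finsum (R (Suc m)) (\<lambda>k. b_word (Suc m) [2..<k]) {2..Suc m}" (is ?l)
    and "whisker C (M \<otimes>\<^sub>o V) N (last_csh m)
      = finsum (R (Suc m)) (\<lambda>k. b_word (Suc m) (rev [k..<Suc m])) {2..Suc m}" (is ?r)
proof -
  interpret braid_family "R (Suc m)" "b (Suc m)" "Suc m" by (rule braid_family_b)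
  have img: "{2..Suc m} = Suc ` {1..m}" by (simp add: image_Suc_atLeastAtMost numeral_2_eq_2)
  have plus: "(+) (Suc 0) = Suc" by auto
  have "whisker C (M \<otimes>\<^sub>o V) N (first_csh m)
      = finsum (R (Suc m)) (\<lambda>k. b_word (Suc m) (map Suc [1..<k])) {1..m}"
    "whisker C (M \<otimes>\<^sub>o V) N (last_csh m)
      = finsum (R (Suc m)) (\<lambda>k. b_word (Suc m) (map Suc (rev [k..<m]))) {1..m}"
    unfolding csh_first[OF objs(1) neg_sigma_hom assms] csh_last[OF objs(1) neg_sigma_hom assms]
    using whisker_sum_words[of "{1..m}" "\<lambda>k. [1..<k]" m 1 0]
      whisker_sum_words[of "{1..m}" "\<lambda>k. rev [k..<m]" m 1 0]
    by (simp_all add: atLeastLessThan_subset_iff plus)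
  moreover have "finsum (R (Suc m)) (\<lambda>k. b_word (Suc m) [2..<k]) {2..Suc m}
      = finsum (R (Suc m)) (\<lambda>k. b_word (Suc m) (map Suc [1..<k])) {1..m}"
    unfolding map_Suc_upt
    by (subst img, subst finsum_reindex) (auto simp: numeral_2_eq_2 intro!: W_closed[simplified] simp del: upt_Suc)
  moreover have "finsum (R (Suc m)) (\<lambda>k. b_word (Suc m) (rev [k..<Suc m])) {2..Suc m}
      = finsum (R (Suc m)) (\<lambda>k. b_word (Suc m) (map Suc (rev [k..<m]))) {1..m}"
    unfolding img rev_map[symmetric] map_Suc_upt
    by (intro finsum_reindex) (auto intro!: W_closed[simplified] simp del: upt_Suc)
  ultimately show ?l ?r by simp_all
qed

abbreviation rho_at :: "nat \<Rightarrow> 'm" where "rho_at n \<equiv> whisker C \<I> (T (n - 1) \<otimes>\<^sub>o N) \<rho>"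
abbreviation lam_at :: "nat \<Rightarrow> 'm" where "lam_at n \<equiv> whisker C (M \<otimes>\<^sub>o T (n - 1)) \<I> lam"

lemma rho_at_hom: "rho_at (Suc n) \<in> Hom (A (Suc n)) (A n)"
  using rho_hom A_split[of "Suc n" 1 n] A_split[of n 0 n]
  by (intro whisker_hom') auto

lemma lam_at_hom: "lam_at (Suc n) \<in> Hom (A (Suc n)) (A n)"
  using lam_hom A_split[of "Suc n" n 1] A_split[of n n 0]
  by (intro whisker_hom') auto

lemma whisker_hom_A:
  assumes "c \<in> Hom (T n) (T n)"
  shows "whisker C M N c \<in> Hom (A n) (A n)"
    and "whisker C (M \<otimes>\<^sub>o V) N c \<in> Hom (A (Suc n)) (A (Suc n))"
    and "whisker C M (V \<otimes>\<^sub>o N) c \<in> Hom (A (Suc n)) (A (Suc n))"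
  using assms A_split[of n n 0] A_split[of "Suc n" "Suc n" 0] A_split[of "Suc n" n 1]
  by (auto intro!: whisker_hom')

lemma d_rho_eq: "n \<ge> 1 \<Longrightarrow> d_rho C V \<sigma> M \<rho> N n = rho_at n \<cdot> whisker C M N (first_csh n)"
  using rho_hom ident_hom[of "T (n - 1)"] ident_hom[of N]
  by (simp add: d_rho_def whisker_def unit_arr_left Hom_Arr ten_arr_assoc ten_ident)

lemma d_lambda_eq:
  "n \<ge> 1 \<Longrightarrow> d_lambda C V \<sigma> M N lam n = scale_arr C ((-1) ^ (n - 1)) (lam_at n \<cdot> whisker C M N (last_csh n))"
  using lam_hom
  by (simp add: d_lambda_def whisker_unit_right ten_ident) (simp add: whisker_def)

lemma whisker_rho_at:
  assumes "c \<in> Hom (T m) (T m)"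
  shows "whisker C M N c \<cdot> rho_at (Suc m) = rho_at (Suc m) \<cdot> whisker C (M \<otimes>\<^sub>o V) N c"
  using whisker_commute[of \<I> N \<I>, OF _ _ _ rho_hom assms] by simp

lemma whisker_lam_at:
  assumes "c \<in> Hom (T m) (T m)"
  shows "whisker C M N c \<cdot> lam_at (Suc m) = lam_at (Suc m) \<cdot> whisker C M (V \<otimes>\<^sub>o N) c"
  using whisker_commute[of M \<I> \<I>, OF _ _ _ assms lam_hom] by simp

lemma rho_at_lam_at_commute: "rho_at (Suc p) \<cdot> lam_at (Suc (Suc p)) = lam_at (Suc p) \<cdot> rho_at (Suc (Suc p))"
  using whisker_commute[of \<I> \<I> "T p", OF _ _ _ rho_hom lam_hom] tpow_Suc_right[of V p]
  by simp

text \<open>The right module axiom, whiskered by the remaining strands.\<close>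

lemma rho_at_rho_at_absorbs:
  "(rho_at (Suc p) \<cdot> rho_at (Suc (Suc p))) \<cdot> braid_at \<sigma> (Suc (Suc p)) 1 = rho_at (Suc p) \<cdot> rho_at (Suc (Suc p))"
proof -
  let ?w = "whisker C \<I> (T p \<otimes>\<^sub>o N)"
  have rV: "\<rho> \<otimes>\<^sub>m \<i>\<d> V \<in> Hom (M \<otimes>\<^sub>o V \<otimes>\<^sub>o V) (M \<otimes>\<^sub>o V)"
    and Ms: "\<i>\<d> M \<otimes>\<^sub>m \<sigma> \<in> Hom (M \<otimes>\<^sub>o V \<otimes>\<^sub>o V) (M \<otimes>\<^sub>o V \<otimes>\<^sub>o V)"
    using ten_hom[OF rho_hom ident_hom[of V]] ten_hom[OF ident_hom[of M] sigma_hom] by simp_all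
  have "rho_at (Suc (Suc p)) = ?w (\<rho> \<otimes>\<^sub>m \<i>\<d> V)"
    using rho_hom whisker_whisker[of \<I> "T p \<otimes>\<^sub>o N" \<I> V \<rho>] by (simp add: whisker_unit_left)
  moreover have "braid_at \<sigma> (Suc (Suc p)) 1 = ?w (\<i>\<d> M \<otimes>\<^sub>m \<sigma>)"
    using sigma_hom whisker_whisker[of \<I> "T p \<otimes>\<^sub>o N" M \<I> \<sigma>]
    by (simp add: whisker_unit_right braid_at_def)
  moreover have "?w (\<rho> \<cdot> (\<rho> \<otimes>\<^sub>m \<i>\<d> V)) = ?w (\<rho> \<cdot> (\<rho> \<otimes>\<^sub>m \<i>\<d> V) \<cdot> (\<i>\<d> M \<otimes>\<^sub>m \<sigma>))"
    using right_module by (simp add: right_braided_module_def)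
  ultimately show ?thesis
    using whisker_cmp[of \<I> "T p \<otimes>\<^sub>o N", OF _ _ rV rho_hom]
      whisker_cmp[of \<I> "T p \<otimes>\<^sub>o N", OF _ _ Ms cmp_hom[OF rV rho_hom]] by simp
qed

text \<open>The left module axiom, whiskered by the remaining strands.\<close>

lemma lam_at_lam_at_absorbs:
  "(lam_at (Suc p) \<cdot> lam_at (Suc (Suc p))) \<cdot> braid_at \<sigma> (Suc (Suc p)) (Suc p) = lam_at (Suc p) \<cdot> lam_at (Suc (Suc p))"
proof -
  let ?w = "whisker C (M \<otimes>\<^sub>o T p) \<I>"
  have Vl: "\<i>\<d> V \<otimes>\<^sub>m lam \<in> Hom (V \<otimes>\<^sub>o V \<otimes>\<^sub>o N) (V \<otimes>\<^sub>o N)"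
    and sN: "\<sigma> \<otimes>\<^sub>m \<i>\<d> N \<in> Hom (V \<otimes>\<^sub>o V \<otimes>\<^sub>o N) (V \<otimes>\<^sub>o V \<otimes>\<^sub>o N)"
    using ten_hom[OF ident_hom[of V] lam_hom] ten_hom[OF sigma_hom ident_hom[of N]] by simp_all
  have "lam_at (Suc (Suc p)) = ?w (\<i>\<d> V \<otimes>\<^sub>m lam)"
    using lam_hom whisker_whisker[of "M \<otimes>\<^sub>o T p" \<I> V \<I> lam] tpow_Suc_right[of V p]
    by (simp add: whisker_unit_right)
  moreover have "braid_at \<sigma> (Suc (Suc p)) (Suc p) = ?w (\<sigma> \<otimes>\<^sub>m \<i>\<d> N)"
    using sigma_hom whisker_whisker[of "M \<otimes>\<^sub>o T p" \<I> \<I> N \<sigma>]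
    by (simp add: whisker_unit_left braid_at_def)
  moreover have "?w (lam \<cdot> (\<i>\<d> V \<otimes>\<^sub>m lam)) = ?w (lam \<cdot> (\<i>\<d> V \<otimes>\<^sub>m lam) \<cdot> (\<sigma> \<otimes>\<^sub>m \<i>\<d> N))"
    using left_module by (simp add: left_braided_module_def)
  ultimately show ?thesis
    using whisker_cmp[of "M \<otimes>\<^sub>o T p" \<I>, OF _ _ Vl lam_hom]
      whisker_cmp[of "M \<otimes>\<^sub>o T p" \<I>, OF _ _ sN cmp_hom[OF Vl lam_hom]] by simp
qed

lemma absorbed_cmp_factor:
  assumes "L \<in> Hom (A n) B" "i \<in> {1..<n}" "L \<cdot> braid_at \<sigma> n i = L"
    and "\<exists>Z\<in>Hom (A n) (A n). X = (\<i>\<d> (A n) \<oplus>\<^sub>m b n i) \<cdot> Z"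
  shows "L \<cdot> X = \<o> (A n) B"
proof -
  obtain Z where Z: "Z \<in> Hom (A n) (A n)" "X = (\<i>\<d> (A n) \<oplus>\<^sub>m b n i) \<cdot> Z" using assms(4) by blast
  have "\<i>\<d> (A n) \<oplus>\<^sub>m b n i \<in> Hom (A n) (A n)"
    using assms(2) by (intro plus_hom ident_hom braid_at_hom neg_sigma_hom) auto
  then have "L \<cdot> X = (L \<cdot> (\<i>\<d> (A n) \<oplus>\<^sub>m b n i)) \<cdot> Z"
    unfolding Z(2) using Z(1) assms(1) by (intro cmp_assoc[symmetric])
  also have "L \<cdot> (\<i>\<d> (A n) \<oplus>\<^sub>m b n i) = \<o> (A n) B"
    unfolding b_eq_neg using assms(1,2,3) sigma_hom
    by (intro absorbed_cmp_one_minus braid_at_hom)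
  finally show ?thesis using Z(1) Hom_Obj(2)[OF assms(1)] by (simp add: cmp_zero_left)
qed

abbreviation rho_diff :: "nat \<Rightarrow> 'm" where "rho_diff n \<equiv> rho_at n \<cdot> whisker C M N (first_csh n)"
abbreviation lam_diff :: "nat \<Rightarrow> 'm" where "lam_diff n \<equiv> lam_at n \<cdot> whisker C M N (last_csh n)"

lemma rho_diff_hom: "rho_diff (Suc n) \<in> Hom (A (Suc n)) (A n)"
  by (rule cmp_hom[OF whisker_hom_A(1)[OF csh_hom(1)] rho_at_hom])

lemma lam_diff_hom: "lam_diff (Suc n) \<in> Hom (A (Suc n)) (A n)"
  by (rule cmp_hom[OF whisker_hom_A(1)[OF csh_hom(2)] lam_at_hom])

context
  fixes p :: nat
begin

interpretation B: braid_family "R (Suc (Suc p))" "b (Suc (Suc p))" "Suc (Suc p)"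
  by (rule braid_family_b)

lemma rho_diff_square: "rho_diff (Suc p) \<cdot> rho_diff (Suc (Suc p)) = \<o> (A (Suc (Suc p))) (A p)"
proof -
  have "rho_diff (Suc p) \<cdot> rho_diff (Suc (Suc p)) = (rho_at (Suc p) \<cdot> rho_at (Suc (Suc p)))
      \<cdot> (whisker C (M \<otimes>\<^sub>o V) N (first_csh (Suc p)) \<cdot> whisker C M N (first_csh (Suc (Suc p))))"
    by (rule cmp_slide[OF rho_at_hom whisker_hom_A(1)[OF csh_hom(1)] rho_at_hom whisker_hom_A(2)[OF csh_hom(1)]
          whisker_hom_A(1)[OF csh_hom(1)] whisker_rho_at[OF csh_hom(1)]])
  also have "\<dots> = \<o> (A (Suc (Suc p))) (A p)"
  proof (rule absorbed_cmp_factor)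
    show "\<exists>Z\<in>Hom (A (Suc (Suc p))) (A (Suc (Suc p))).
        whisker C (M \<otimes>\<^sub>o V) N (first_csh (Suc p)) \<cdot> whisker C M N (first_csh (Suc (Suc p)))
        = (\<i>\<d> (A (Suc (Suc p))) \<oplus>\<^sub>m b (Suc (Suc p)) 1) \<cdot> Z"
      using B.coshuffle_square_factor whisker_csh_left(1)[of "Suc p"] whisker_csh(1)[of "Suc (Suc p)"]
      by simp
  qed (use cmp_hom[OF rho_at_hom rho_at_hom] rho_at_rho_at_absorbs in simp_all)
  finally show ?thesis .
qed

lemma lam_diff_square: "lam_diff (Suc p) \<cdot> lam_diff (Suc (Suc p)) = \<o> (A (Suc (Suc p))) (A p)"
proof -
  have "lam_diff (Suc p) \<cdot> lam_diff (Suc (Suc p)) = (lam_at (Suc p) \<cdot> lam_at (Suc (Suc p)))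
      \<cdot> (whisker C M (V \<otimes>\<^sub>o N) (last_csh (Suc p)) \<cdot> whisker C M N (last_csh (Suc (Suc p))))"
    by (rule cmp_slide[OF lam_at_hom whisker_hom_A(1)[OF csh_hom(2)] lam_at_hom whisker_hom_A(3)[OF csh_hom(2)]
          whisker_hom_A(1)[OF csh_hom(2)] whisker_lam_at[OF csh_hom(2)]])
  also have "\<dots> = \<o> (A (Suc (Suc p))) (A p)"
  proof (rule absorbed_cmp_factor)
    show "\<exists>Z\<in>Hom (A (Suc (Suc p))) (A (Suc (Suc p))).
        whisker C M (V \<otimes>\<^sub>o N) (last_csh (Suc p)) \<cdot> whisker C M N (last_csh (Suc (Suc p)))
        = (\<i>\<d> (A (Suc (Suc p))) \<oplus>\<^sub>m b (Suc (Suc p)) (Suc p)) \<cdot> Z"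
      using B.coshuffle_square_factor_reverse whisker_csh_right(2)[of "Suc p"]
        whisker_csh(2)[of "Suc (Suc p)"]
      by simp
  qed (use cmp_hom[OF lam_at_hom lam_at_hom] lam_at_lam_at_absorbs in simp_all)
  finally show ?thesis .
qed

text \<open>Without signs the two mixed composites are equal; the sign of the second differential changes with
  the degree and turns this into anticommutation.\<close>

lemma rho_lam_diff_commute: "lam_diff (Suc p) \<cdot> rho_diff (Suc (Suc p)) = rho_diff (Suc p) \<cdot> lam_diff (Suc (Suc p))"
proof -
  have "lam_diff (Suc p) \<cdot> rho_diff (Suc (Suc p)) = (lam_at (Suc p) \<cdot> rho_at (Suc (Suc p)))
      \<cdot> (whisker C (M \<otimes>\<^sub>o V) N (last_csh (Suc p)) \<cdot> whisker C M N (first_csh (Suc (Suc p))))"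
    by (rule cmp_slide[OF lam_at_hom whisker_hom_A(1)[OF csh_hom(2)] rho_at_hom whisker_hom_A(2)[OF csh_hom(2)]
          whisker_hom_A(1)[OF csh_hom(1)] whisker_rho_at[OF csh_hom(2)]])
  also have "lam_at (Suc p) \<cdot> rho_at (Suc (Suc p)) = rho_at (Suc p) \<cdot> lam_at (Suc (Suc p))"
    by (rule rho_at_lam_at_commute[symmetric])
  also have "whisker C (M \<otimes>\<^sub>o V) N (last_csh (Suc p)) \<cdot> whisker C M N (first_csh (Suc (Suc p)))
      = whisker C M (V \<otimes>\<^sub>o N) (first_csh (Suc p)) \<cdot> whisker C M N (last_csh (Suc (Suc p)))"
    using B.coshuffles_exchange whisker_csh_left(2)[of "Suc p"] whisker_csh(1)[of "Suc (Suc p)"]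
      whisker_csh_right(1)[of "Suc p"] whisker_csh(2)[of "Suc (Suc p)"]
    by simp
  also have "(rho_at (Suc p) \<cdot> lam_at (Suc (Suc p))) \<cdot> \<dots> = rho_diff (Suc p) \<cdot> lam_diff (Suc (Suc p))"
    by (rule cmp_slide[OF rho_at_hom whisker_hom_A(1)[OF csh_hom(1)] lam_at_hom whisker_hom_A(3)[OF csh_hom(1)]
          whisker_hom_A(1)[OF csh_hom(2)] whisker_lam_at[OF csh_hom(1)], symmetric])
  finally show ?thesis .
qed

end

theorem tensor_bidifferential_coshuffles:
  "tensor_bidifferential C V M N (d_rho C V \<sigma> M \<rho> N) (d_lambda C V \<sigma> M N lam)"
  unfolding tensor_bidifferential_def Let_def
proof (intro conjI allI impI)
  fix n :: nat
  assume "0 < n"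
  then have n: "n \<ge> 1" by simp
  show "d_rho C V \<sigma> M \<rho> N n \<in> Hom (A n) (A (n - 1))"
    unfolding d_rho_eq[OF n] using rho_diff_hom[of "n - 1"] n by simp
  show "d_lambda C V \<sigma> M N lam n \<in> Hom (A n) (A (n - 1))"
  proof -
    have lam_diff: "lam_diff n \<in> Hom (A n) (A (n - 1))" using lam_diff_hom[of "n - 1"] n by simp
    show ?thesis
      unfolding d_lambda_eq[OF n] scale_sign[OF lam_diff] using lam_diff neg_hom[OF lam_diff] by simp
  qed
next
  fix n :: nat
  assume "1 < n"
  then obtain p where n: "n = Suc (Suc p)" by (metis One_nat_def less_imp_Suc_add add_Suc)
  note rho_diff = rho_diff_hom[of p] rho_diff_hom[of "Suc p"]
  note lam_diff = lam_diff_hom[of p] lam_diff_hom[of "Suc p"]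
  let ?dr = "d_rho C V \<sigma> M \<rho> N" and ?dl = "d_lambda C V \<sigma> M N lam"
  \<comment> \<open>The exponents \<open>n - 2\<close> and \<open>n - 1\<close> have opposite parity, so exactly one of the two
    differentials is negated.\<close>
  have eqs: "?dr (n - 1) = rho_diff (Suc p)" "?dr n = rho_diff (Suc (Suc p))"
    "?dl (n - 1) = (if even p then lam_diff (Suc p) else neg_arr C (lam_diff (Suc p)))"
    "?dl n = (if even p then neg_arr C (lam_diff (Suc (Suc p))) else lam_diff (Suc (Suc p)))"
    using d_rho_eq[of "Suc p"] d_rho_eq[of "Suc (Suc p)"] d_lambda_eq[of "Suc p"]
      d_lambda_eq[of "Suc (Suc p)"] scale_sign[OF lam_diff(1)] scale_sign[OF lam_diff(2), of "Suc p"]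
    by (simp_all add: n)
  have A: "A (n - 2) = A p" "A n = A (Suc (Suc p))" by (simp_all add: n)
  have neg0: "neg_arr C (\<o> (A (Suc (Suc p))) (A p)) = \<o> (A (Suc (Suc p))) (A p)"
    by (rule neg_unique[OF zero_hom zero_hom zero_plus_zero]) simp_all
  show "?dr (n - 1) \<cdot> ?dr n = \<o> (A n) (A (n - 2))"
    unfolding eqs A by (rule rho_diff_square)
  show "?dl (n - 1) \<cdot> ?dl n = \<o> (A n) (A (n - 2))"
    unfolding eqs A using lam_diff_square[of p] neg0 cmp_neg_left[OF lam_diff(2,1)] cmp_neg_right[OF lam_diff(2,1)]
    by simp
  show "(?dl (n - 1) \<cdot> ?dr n) \<oplus>\<^sub>m (?dr (n - 1) \<cdot> ?dl n) = \<o> (A n) (A (n - 2))"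
    unfolding eqs A using rho_lam_diff_commute[of p] cmp_neg_left[OF rho_diff(2) lam_diff(1)] cmp_neg_right[OF lam_diff(2) rho_diff(1)]
      plus_neg[OF cmp_hom[OF lam_diff(2) rho_diff(1)]] neg_plus[OF cmp_hom[OF lam_diff(2) rho_diff(1)]]
    by simp
qed

end

theorem mainTheorem5:
  fixes C :: "('o, 'm, 'z) pmcat_scheme"
    and V M N :: 'o
    and \<sigma> \<rho> lam :: 'm
  assumes "preadditive_strict_monoidal_category C"
    and "prebraided_object C V \<sigma>"
    and "right_braided_module C V \<sigma> M \<rho>"
    and "left_braided_module C V \<sigma> N lam"
  shows "tensor_bidifferential C V M N (d_rho C V \<sigma> M \<rho> N) (d_lambda C V \<sigma> M N lam)"
proof -
  interpret braided_coefficients C V \<sigma> M \<rho> N lam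
    using assms by (simp add: braided_coefficients_def braided_coefficients_axioms_def)
  show ?thesis by (rule tensor_bidifferential_coshuffles)
qed

end
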